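(* Let $\zeta\in(-1/2,\infty)$. Then there exist constants $c_1,\dots,c_8\in(0,\infty)$, depending only on $\zeta$, such that for all $r,s,t>0$, \[ c_1\, t^{-1/2}\frac{\exp\!\big(-\tfrac{(r-s)^2}{c_2 t}\big)}{(rs+t)^{\zeta}}\le p_\zeta^{(2)}(t,r,s)\le c_3\, t^{-1/2}\frac{\exp\!\big(-\tfrac{(r-s)^2}{c_4 t}\big)}{(rs+t)^{\zeta}}, \] and \[ c_5\, A_\zeta(t,r,s)\exp\!\Big(-\tfrac{(r-s)^2}{c_6 t}\Big)\le p_\zeta^{(2)}(t,r,s)\le c_7\, A_\zeta(t,r,s)\exp\!\Big(-\tfrac{(r-s)^2}{c_8 t}\Big), \] where $A_\zeta(t,r,s):=\big(1\wedge \tfrac{r}{t^{1/2}}\big)^{\zeta}\big(1\wedge \tfrac{s}{t^{1/2}}\big)^{\zeta}\big(\tfrac{1}{rs}\big)^{\zeta} t^{-1/2}$. Moreover, for every $\alpha\in(0,2)$ there is a constant $K\ge1$, depending only on $\zeta$ and $\alpha$, such that for all $r,s,t>0$, \[ K^{-1} Q\le p_\zeta^{(\alpha)}(t,r,s)\le K Q,\qquad Q:=\frac{t}{|r-s|^{1+\alpha}(r+s)^{2\zeta}+t^{\frac{1+\alpha}{\alpha}}\big(t^{\frac1\alpha}+r+s\big)^{2\zeta}}. \]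
   Context: For $z\in\mathbb{C}\setminus(-\infty,0]$ and $\nu\in\mathbb{C}$, $I_\nu$ denotes the modified Bessel function of the first kind of order $\nu$. For $\zeta\in(-1/2,\infty)$ the Bessel heat kernel is \[ p_\zeta^{(2)}(t,r,s):=\frac{(rs)^{1/2-\zeta}}{2t}\exp\Big(-\frac{r^2+s^2}{4t}\Big)I_{\zeta-1/2}\Big(\frac{rs}{2t}\Big),\quad r,s,t>0. \] For $\alpha\in(0,2)$ and $t>0$, let $\sigma_t^{(\alpha/2)}$ be the probability density on $(0,\infty)$ of the $\alpha/2$-stable subordinator, i.e. $e^{-t\lambda^{\alpha/2}}=\int_0^\infty e^{-\tau\lambda}\sigma_t^{(\alpha/2)}(\tau)\,d\tau$ for all $\lambda\ge0$. The subordinated Bessel heat kernel is $p_\zeta^{(\alpha)}(t,r,s):=\int_0^\infty p_\zeta^{(2)}(\tau,r,s)\,\sigma_t^{(\alpha/2)}(\tau)\,d\tau$ for $r,s,t>0$. Notation: $a\wedge b=\min\{a,b\}$. *)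

theory Defs
  imports "HOL-Analysis.Analysis"
begin

text \<open>Modified Bessel function of the first kind, for real argument x > 0 and real order nu,
  via its defining power series (valid whenever nu is not a negative integer; here nu > -1).\<close>
definition bessel_I :: "real \<Rightarrow> real \<Rightarrow> real" where
  "bessel_I nu x = (\<Sum>k. (x / 2) powr (2 * real k + nu) / (fact k * Gamma (real k + nu + 1)))"

definition bessel_heat :: "real \<Rightarrow> real \<Rightarrow> real \<Rightarrow> real \<Rightarrow> real" where
  "bessel_heat \<zeta> t r s =
     (r * s) powr (1/2 - \<zeta>) / (2 * t) * exp (- (r\<^sup>2 + s\<^sup>2) / (4 * t))
     * bessel_I (\<zeta> - 1/2) (r * s / (2 * t))"

definition stable_subordinator_density :: "real \<Rightarrow> (real \<Rightarrow> real \<Rightarrow> real) \<Rightarrow> bool" where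
  "stable_subordinator_density \<alpha> \<sigma> \<longleftrightarrow>
     (\<forall>t>0. (\<forall>\<tau>>0. \<sigma> t \<tau> \<ge> 0) \<and>
        (\<forall>l\<ge>0. ((\<lambda>\<tau>. exp (- \<tau> * l) * \<sigma> t \<tau>) has_integral exp (- t * l powr (\<alpha> / 2))) {0<..}))"

definition sub_bessel_heat :: "(real \<Rightarrow> real \<Rightarrow> real) \<Rightarrow> real \<Rightarrow> real \<Rightarrow> real \<Rightarrow> real \<Rightarrow> real" where
  "sub_bessel_heat \<sigma> \<zeta> t r s = integral {0<..} (\<lambda>\<tau>. bessel_heat \<zeta> \<tau> r s * \<sigma> t \<tau>)"

definition A_zeta :: "real \<Rightarrow> real \<Rightarrow> real \<Rightarrow> real \<Rightarrow> real" where
  "A_zeta \<zeta> t r s = (min 1 (r / sqrt t)) powr \<zeta> * (min 1 (s / sqrt t)) powr \<zeta>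
     * (1 / (r * s)) powr \<zeta> * t powr (-1/2)"

definition Q_bound :: "real \<Rightarrow> real \<Rightarrow> real \<Rightarrow> real \<Rightarrow> real \<Rightarrow> real" where
  "Q_bound \<zeta> \<alpha> t r s = t / (\<bar>r - s\<bar> powr (1 + \<alpha>) * (r + s) powr (2 * \<zeta>)
     + t powr ((1 + \<alpha>) / \<alpha>) * (t powr (1 / \<alpha>) + r + s) powr (2 * \<zeta>))"

end

theory Submission
  imports Defs "HOL-Real_Asymp.Real_Asymp"
begin

text \<open>
  By the duplication formula for the Gamma function, the power series of \<open>I\<^sub>\<nu>\<close> has, up to the factor
  \<open>(z / 2) powr \<nu>\<close>, coefficients comparable to \<open>(k + 1) powr (- \<nu> - 1/2) / (2 k)!\<close>. It is thus a power
  moment of the weights of the cosh series, and such a moment of order \<open>q\<close> is comparable to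
  \<open>exp z * (1 + z) powr q\<close>: shifting the series relates the orders \<open>q + 2\<close> and \<open>q\<close>, upper bounds for other
  orders follow by interpolation, and lower bounds from the upper bound for \<open>- q\<close>. This gives the Gaussian
  bounds with \<open>c\<^sub>2 = c\<^sub>4 = 4\<close>; replacing \<open>r s + t\<close> by \<open>max r (sqrt t) * max s (sqrt t)\<close> costs a power of
  \<open>1 + \<bar>r - s\<bar> / sqrt t\<close>, which a part of the Gaussian absorbs.

  For the subordinated kernel no pointwise bounds on the stable density are needed: with
  \<open>D = max \<bar>r - s\<bar> (t powr (1 / \<alpha>))\<close>, the heat kernel at time \<open>\<tau>\<close> is bounded above and below, as a function
  of \<open>u = \<tau> / D\<^sup>2\<close>, by combinations of exponentials \<open>exp (- l u)\<close>, whose integrals are given by the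
  Laplace transform.
\<close>


section \<open>Comparability up to a factor\<close>

definition within_factor :: "real \<Rightarrow> real \<Rightarrow> real \<Rightarrow> bool" where
  "within_factor K x y \<longleftrightarrow> 0 < x \<and> 0 < y \<and> x \<le> K * y \<and> y \<le> K * x"

lemma within_factor_ge_1:
  assumes "within_factor K x y"
  shows "1 \<le> K"
proof (rule ccontr)
  assume "\<not> 1 \<le> K"
  moreover from assms have "0 < x" "0 < y" "x \<le> K * y" "y \<le> K * x"
    by (auto simp: within_factor_def)
  ultimately have "K * y < 1 * y" "K * x < 1 * x"
    by (auto intro: mult_strict_right_mono)
  with \<open>x \<le> K * y\<close> \<open>y \<le> K * x\<close> show False by simp
qed

lemma within_factor_maxI:
  assumes "0 < x" "0 < y" "x \<le> B * y" "y \<le> C * x"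
  shows "within_factor (max B C) x y"
proof -
  have "B * y \<le> max B C * y" "C * x \<le> max B C * x"
    using assms by (auto intro: mult_right_mono)
  with assms show ?thesis unfolding within_factor_def by linarith
qed

lemma within_factor_refl: "0 < x \<Longrightarrow> 1 \<le> K \<Longrightarrow> within_factor K x x"
  by (simp add: within_factor_def)

lemma within_factor_sym: "within_factor K x y \<Longrightarrow> within_factor K y x"
  by (auto simp: within_factor_def)

lemma within_factor_mono:
  assumes "within_factor K x y" "K \<le> L"
  shows "within_factor L x y"
proof -
  have "K * x \<le> L * x" "K * y \<le> L * y"
    using assms by (auto simp: within_factor_def intro: mult_right_mono)
  with assms(1) show ?thesis unfolding within_factor_def by linarith
qed

lemma within_factor_trans [trans]:
  assumes "within_factor K x y" "within_factor L y z"
  shows "within_factor (K * L) x z"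
proof -
  have K: "0 < K" and L: "0 < L"
    using assms[THEN within_factor_ge_1] by simp_all
  from assms have "x \<le> K * y" "y \<le> L * z" "z \<le> L * y" "y \<le> K * x"
    by (auto simp: within_factor_def)
  then have "x \<le> K * (L * z)" "z \<le> L * (K * x)"
    using K L by (meson mult_left_mono order.trans less_imp_le)+
  with assms show ?thesis by (auto simp: within_factor_def mult_ac)
qed

lemma within_factor_mult:
  assumes "within_factor K x y" "within_factor L u v"
  shows "within_factor (K * L) (x * u) (y * v)"
proof -
  have "x * u \<le> (K * y) * (L * v)" "y * v \<le> (K * x) * (L * u)"
    using assms assms[THEN within_factor_ge_1]
    by (auto simp: within_factor_def intro!: mult_mono)
  with assms show ?thesis by (auto simp: within_factor_def mult_ac)
qed

lemma within_factor_mult_left: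
  assumes "0 < c" "within_factor K x y"
  shows "within_factor K (c * x) (c * y)"
  using within_factor_mult[OF within_factor_refl[OF assms(1), of 1] assms(2)] by simp

lemma within_factor_inverse:
  assumes "within_factor K x y"
  shows "within_factor K (inverse x) (inverse y)"
  using assms by (auto simp: within_factor_def field_simps)

lemma within_factor_divide:
  assumes "within_factor K x y" "within_factor L u v"
  shows "within_factor (K * L) (x / u) (y / v)"
  using within_factor_mult[OF assms(1) within_factor_inverse[OF assms(2)]]
  by (simp add: divide_inverse)

lemma within_factor_add:
  assumes "within_factor K x y" "within_factor K u v"
  shows "within_factor K (x + u) (y + v)"
  using assms by (auto simp: within_factor_def algebra_simps intro: add_mono)

lemma within_factor_powr:
  assumes "within_factor K x y"
  shows "within_factor (K powr \<bar>q\<bar>) (x powr q) (y powr q)"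
proof -
  have pos: "0 < x" "0 < y" and K: "1 \<le> K" and le: "x \<le> K * y" "y \<le> K * x"
    using assms within_factor_ge_1[OF assms] by (auto simp: within_factor_def)
  have powr_le: "a powr q \<le> K powr \<bar>q\<bar> * b powr q"
    if "0 < a" "0 < b" "a \<le> K * b" "b \<le> K * a" for a b
  proof (cases "0 \<le> q")
    case True
    then have "a powr q \<le> (K * b) powr q"
      using that by (intro powr_mono2) auto
    then show ?thesis using True by (simp add: powr_mult)
  next
    case False
    then have "(K * a) powr q \<le> b powr q"
      using that by (intro powr_mono2') auto
    then show ?thesis
      using False K by (simp add: powr_mult powr_minus field_simps)
  qed
  show ?thesis
    using powr_le[OF pos le] powr_le[OF pos(2,1) le(2,1)] pos by (simp add: within_factor_def)
qed

lemma powr_within_factor_2: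
  fixes x y q :: real
  assumes "0 < x" "x \<le> y" "y \<le> 2 * x"
  shows "within_factor (2 powr \<bar>q\<bar>) (x powr q) (y powr q)"
  using assms by (intro within_factor_powr) (simp add: within_factor_def)

lemma within_factor_suminf:
  fixes f g :: "nat \<Rightarrow> real"
  assumes fg: "\<And>n. within_factor K (f n) (g n)" and g: "summable g"
  shows "summable f" "within_factor K (suminf f) (suminf g)"
proof -
  have pos: "0 < f n" "0 < g n" and le: "f n \<le> K * g n" "g n \<le> K * f n" for n
    using fg[of n] by (auto simp: within_factor_def)
  show f: "summable f"
  proof (rule summable_comparison_test'[OF summable_mult[OF g, of K]])
    show "norm (f n) \<le> K * g n" for n using pos[of n] le[of n] by simp
  qed
  have "suminf f \<le> K * suminf g"
    using suminf_le[OF le(1) f summable_mult[OF g]] suminf_mult[OF g] by simp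
  moreover have "suminf g \<le> K * suminf f"
    using suminf_le[OF le(2) g summable_mult[OF f]] suminf_mult[OF f] by simp
  ultimately show "within_factor K (suminf f) (suminf g)"
    using suminf_pos[OF f pos(1)] suminf_pos[OF g pos(2)] by (simp add: within_factor_def)
qed

lemma within_factor_if_ratio_tendsto:
  fixes f g :: "nat \<Rightarrow> real"
  assumes lim: "(\<lambda>n. f n / g n) \<longlonglongrightarrow> L" and L: "0 < L"
    and pos: "\<And>n. 0 < f n" "\<And>n. 0 < g n"
  obtains K where "\<And>n. within_factor K (f n) (g n)"
proof -
  have "Bseq (\<lambda>n. f n / g n)"
    using lim by (intro convergent_imp_Bseq convergentI)
  then obtain B where B: "\<And>n. norm (f n / g n) \<le> B" by (auto simp: Bseq_def)
  have "(\<lambda>n. inverse (f n / g n)) \<longlonglongrightarrow> inverse L"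
    using lim L by (intro tendsto_inverse) auto
  then have "Bseq (\<lambda>n. inverse (f n / g n))"
    by (intro convergent_imp_Bseq convergentI)
  then obtain b where b: "\<And>n. norm (inverse (f n / g n)) \<le> b" by (auto simp: Bseq_def)
  have "within_factor (max B b) (f n) (g n)" for n
  proof -
    have "f n \<le> B * g n" "g n \<le> b * f n"
      using B[of n] b[of n] pos[of n] by (auto simp: pos_divide_le_eq)
    then show ?thesis using pos[of n] by (intro within_factor_maxI)
  qed
  then show ?thesis by (rule that)
qed

section \<open>Moments of the hyperbolic cosine series\<close>

definition cosh_moment :: "real \<Rightarrow> real \<Rightarrow> real" where
  "cosh_moment q z = (\<Sum>k. z ^ (2 * k) / fact (2 * k) * (real k + 1) powr q)"

lemma summable_cosh_moment:
  "summable (\<lambda>k. z ^ (2 * k) / fact (2 * k) * (real k + 1) powr q)"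
proof -
  have "(\<lambda>k. (real k + 1) powr q / 2 ^ k) \<longlonglongrightarrow> 0" by real_asymp
  then have "Bseq (\<lambda>k. (real k + 1) powr q / 2 ^ k)"
    by (intro convergent_imp_Bseq convergentI)
  then obtain C where C: "\<And>k. norm ((real k + 1) powr q / 2 ^ k) \<le> C"
    by (auto simp: Bseq_def)
  have "summable (\<lambda>k. C * (inverse (fact k) * (2 * z\<^sup>2) ^ k))"
    by (intro summable_mult summable_exp)
  then show ?thesis
  proof (rule summable_comparison_test')
    fix k
    have "(real k + 1) powr q \<le> C * 2 ^ k" using C[of k] by (simp add: field_simps)
    moreover have "z ^ (2 * k) / fact (2 * k) \<le> z ^ (2 * k) / fact k"
      by (intro divide_left_mono fact_mono) auto
    ultimately have "z ^ (2 * k) / fact (2 * k) * (real k + 1) powr q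
        \<le> z ^ (2 * k) / fact k * (C * 2 ^ k)"
      by (intro mult_mono) auto
    moreover have "(2 * z\<^sup>2) ^ k = 2 ^ k * z ^ (2 * k)"
      by (simp add: power_mult power_mult_distrib)
    moreover have "0 \<le> z ^ (2 * k) / fact (2 * k) * (real k + 1) powr q" by simp
    ultimately show "norm (z ^ (2 * k) / fact (2 * k) * (real k + 1) powr q)
        \<le> C * (inverse (fact k) * (2 * z\<^sup>2) ^ k)"
      by (simp add: divide_inverse mult_ac)
  qed
qed

lemma cosh_moment_0: "cosh_moment 0 z = cosh z"
proof -
  let ?g = "\<lambda>n. if even n then z ^ n /\<^sub>R fact n else 0"
  have "(\<lambda>k. ?g (2 * k)) sums cosh z \<longleftrightarrow> ?g sums cosh z"
    by (rule sums_mono_reindex) (auto simp: strict_mono_def)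
  then have "(\<lambda>k. z ^ (2 * k) / fact (2 * k) * (real k + 1) powr 0) sums cosh z"
    using cosh_converges[of z] by (simp add: divide_inverse mult.commute)
  then show ?thesis by (simp add: cosh_moment_def sums_iff)
qed

lemma cosh_within_factor_exp:
  fixes z :: real
  assumes "0 \<le> z"
  shows "within_factor 2 (cosh z) (exp z)"
proof -
  have "exp (- z) \<le> 3 * exp z"
    using assms order.trans[of "exp (- z)" "exp z" "3 * exp z"] by simp
  then show ?thesis by (simp add: within_factor_def cosh_field_def add_pos_pos)
qed

lemma cosh_series_shift:
  fixes z :: real
  assumes "(\<lambda>k. z ^ (2 * k) / fact (2 * k) * f (Suc k)) sums S"
  shows "(\<lambda>k. z ^ (2 * k) / fact (2 * k) * f k * (2 * real k * (2 * real k - 1))) sums (z\<^sup>2 * S)"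
    (is "?b sums _")
proof -
  have shift: "?b (Suc k) = z\<^sup>2 * (z ^ (2 * k) / fact (2 * k) * f (Suc k))" for k
  proof -
    define m where "m = 2 * real (Suc k) * (2 * real (Suc k) - 1)"
    have Suc_k: "fact (2 * Suc k) = m * fact (2 * k)" "z ^ (2 * Suc k) = z\<^sup>2 * z ^ (2 * k)"
      by (simp_all add: m_def algebra_simps power2_eq_square)
    have "m \<noteq> 0" by (simp add: m_def)
    then show ?thesis unfolding Suc_k m_def[symmetric] by simp
  qed
  have "(\<lambda>k. ?b (Suc k)) sums (z\<^sup>2 * S)" unfolding shift using assms by (rule sums_mult)
  from sums_Suc[OF this] show ?thesis by simp
qed

lemma Suc_square_within_factor:
  "within_factor 4 ((real k + 1)\<^sup>2) (1 + 2 * real k * (2 * real k - 1))"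
proof -
  define p where "p = 1 + 2 * real k * (2 * real k - 1)"
  define s where "s = (real k + 1)\<^sup>2"
  have "4 * p = s + 15 * (real k - 1/3)\<^sup>2 + 4/3" "4 * s = p + 10 * real k + 3"
    by (simp_all add: p_def s_def power2_eq_square algebra_simps)
  moreover have "0 < s" "0 \<le> (real k - 1/3)\<^sup>2" by (simp_all add: s_def)
  ultimately have "0 < p" "s \<le> 4 * p" "p \<le> 4 * s" by linarith+
  with \<open>0 < s\<close> have "within_factor 4 s p" by (simp add: within_factor_def)
  then show ?thesis unfolding p_def s_def .
qed

lemma one_plus_square_within_factor:
  fixes z :: real
  assumes "0 \<le> z"
  shows "within_factor 2 (1 + z\<^sup>2) ((1 + z)\<^sup>2)"
proof -
  have "2 * (1 + z\<^sup>2) = (1 + z)\<^sup>2 + (1 - z)\<^sup>2" by (simp add: power2_eq_square algebra_simps)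
  then show ?thesis using assms by (simp add: within_factor_def power2_sum add_pos_nonneg)
qed

text \<open>Up to a factor, \<open>(k + 1)\<^sup>2\<close> is \<open>1 + 2 k (2 k - 1)\<close>, and the factor \<open>2 k (2 k - 1)\<close> shifts the cosh
  series by one term.\<close>

lemma cosh_moment_add_2:
  assumes z: "0 < z"
  shows "within_factor (8 * 2 powr \<bar>q\<bar>) (cosh_moment (q + 2) z) ((1 + z)\<^sup>2 * cosh_moment q z)"
proof -
  define w where "w k = z ^ (2 * k) / fact (2 * k)" for k
  define a where "a k = w k * (real k + 1) powr q" for k
  define shifted where "shifted k = w k * (real (Suc k) + 1) powr q" for k
  have w: "0 < w k" for k using z by (simp add: w_def)
  have a: "summable a" unfolding a_def w_def by (rule summable_cosh_moment)
  have a_sum: "cosh_moment q z = suminf a" unfolding cosh_moment_def a_def w_def ..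
  have "within_factor (2 powr \<bar>q\<bar>) (shifted k) (a k)" for k
    unfolding a_def shifted_def
    by (intro within_factor_mult_left w within_factor_sym[OF powr_within_factor_2]) auto
  note shifted = within_factor_suminf[OF this a]
  have "(\<lambda>k. a k * (2 * real k * (2 * real k - 1))) sums (z\<^sup>2 * suminf shifted)"
    using cosh_series_shift[of z "\<lambda>k. (real k + 1) powr q"] shifted(1)
    unfolding a_def shifted_def w_def by (simp add: summable_sums)
  from sums_add[OF summable_sums[OF a] this]
  have sums: "(\<lambda>k. a k * (1 + 2 * real k * (2 * real k - 1))) sums (suminf a + z\<^sup>2 * suminf shifted)"
    by (simp add: distrib_left)
  have "within_factor 4 (a k * (real k + 1)\<^sup>2) (a k * (1 + 2 * real k * (2 * real k - 1)))" for k
    using w by (intro within_factor_mult_left Suc_square_within_factor) (simp add: a_def)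
  from within_factor_suminf(2)[OF this sums_summable[OF sums]]
  have "within_factor 4 (\<Sum>k. a k * (real k + 1)\<^sup>2) (suminf a + z\<^sup>2 * suminf shifted)"
    by (simp only: sums_unique[OF sums, symmetric])
  also have "within_factor (2 powr \<bar>q\<bar>) (suminf a + z\<^sup>2 * suminf shifted) (suminf a + z\<^sup>2 * suminf a)"
    using z shifted(2)
    by (intro within_factor_add within_factor_refl within_factor_mult_left)
       (auto simp: within_factor_def ge_one_powr_ge_zero)
  also have "suminf a + z\<^sup>2 * suminf a = suminf a * (1 + z\<^sup>2)" by (simp add: algebra_simps)
  also have "within_factor 2 (suminf a * (1 + z\<^sup>2)) (suminf a * (1 + z)\<^sup>2)"
    using z shifted(2)
    by (intro within_factor_mult_left one_plus_square_within_factor) (auto simp: within_factor_def)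
  also have "(\<Sum>k. a k * (real k + 1)\<^sup>2) = cosh_moment (q + 2) z"
    by (simp add: cosh_moment_def a_def w_def powr_add mult_ac)
  finally show ?thesis by (simp add: a_sum mult_ac)
qed

lemma cosh_moment_ratio_add_2:
  assumes "0 < z"
  shows "within_factor (8 * 2 powr \<bar>q\<bar>)
    (cosh_moment (q + 2) z / (1 + z) powr (q + 2)) (cosh_moment q z / (1 + z) powr q)"
proof -
  have "(1 + z) powr (q + 2) = (1 + z)\<^sup>2 * (1 + z) powr q"
    using assms by (simp add: powr_add)
  then show ?thesis
    using assms within_factor_divide[OF cosh_moment_add_2[OF assms]
        within_factor_refl[of "(1 + z) powr (q + 2)" 1]]
    by simp
qed

lemma cosh_moment_even_within_factor:
  "\<exists>K. \<forall>z>0. within_factor K (cosh_moment (2 * of_int m) z / (1 + z) powr (2 * of_int m)) (exp z)"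
proof (induction m rule: int_induct[where k = 0])
  case base
  then show ?case using cosh_within_factor_exp by (auto simp: cosh_moment_0 intro!: exI[of _ 2])
next
  case (step1 i)
  then obtain K where "\<forall>z>0. within_factor K
      (cosh_moment (2 * of_int i) z / (1 + z) powr (2 * of_int i)) (exp z)"
    by blast
  with cosh_moment_ratio_add_2[of _ "2 * of_int i"] show ?case
    by (simp add: distrib_left) (blast intro: within_factor_trans)
next
  case (step2 i)
  then obtain K where "\<forall>z>0. within_factor K
      (cosh_moment (2 * of_int i) z / (1 + z) powr (2 * of_int i)) (exp z)"
    by blast
  with cosh_moment_ratio_add_2[of _ "2 * of_int (i - 1)"] show ?case
    by (simp add: right_diff_distrib) (blast intro: within_factor_trans within_factor_sym)
qed

lemma cosh_moment_scaled_sums: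
  "(\<lambda>k. z ^ (2 * k) / fact (2 * k) * ((real k + 1) / y) powr q) sums (cosh_moment q z / y powr q)"
  using sums_divide[OF summable_sums[OF summable_cosh_moment[of z q]], of "y powr q"]
  by (simp add: cosh_moment_def powr_divide)

lemma cosh_moment_interpolation:
  assumes "0 < y" "\<bar>q\<bar> \<le> m"
  shows "cosh_moment q z / y powr q
    \<le> cosh_moment m z / y powr m + cosh_moment (- m) z / y powr (- m)"
proof (rule sums_le[OF _ cosh_moment_scaled_sums
      sums_add[OF cosh_moment_scaled_sums cosh_moment_scaled_sums]])
  fix k
  define x where "x = (real k + 1) / y"
  have "0 < x" using assms by (simp add: x_def)
  have "x powr q \<le> x powr m + x powr (- m)"
  proof (cases "1 \<le> x")
    case True
    then have "x powr q \<le> x powr m" using assms by (intro powr_mono) auto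
    then show ?thesis by (simp add: add_increasing2)
  next
    case False
    then have "x powr q \<le> x powr (- m)" using assms \<open>0 < x\<close> by (intro powr_mono') auto
    then show ?thesis by (simp add: add_increasing)
  qed
  from mult_left_mono[OF this, of "z ^ (2 * k) / fact (2 * k)"]
  show "z ^ (2 * k) / fact (2 * k) * x powr q
      \<le> z ^ (2 * k) / fact (2 * k) * x powr m + z ^ (2 * k) / fact (2 * k) * x powr (- m)"
    by (simp add: distrib_left)
qed

lemma two_cosh_le_cosh_moments:
  assumes "0 < y" "0 < \<mu>"
  shows "2 * cosh z \<le> \<mu> * (cosh_moment q z / y powr q) + cosh_moment (- q) z / y powr (- q) / \<mu>"
proof -
  have "(\<lambda>k. z ^ (2 * k) / fact (2 * k)) sums cosh z"
    using cosh_moment_scaled_sums[of z 1 0] by (simp add: cosh_moment_0)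
  then show ?thesis
  proof (rule sums_le[OF _ sums_mult
        sums_add[OF sums_mult[OF cosh_moment_scaled_sums] sums_divide[OF cosh_moment_scaled_sums]],
        rotated])
    fix k
    define x where "x = ((real k + 1) / y) powr q"
    define w where "w = z ^ (2 * k) / fact (2 * k)"
    have x: "0 < x" "((real k + 1) / y) powr (- q) = 1 / x"
      using assms by (simp_all add: x_def powr_minus_divide)
    have "0 \<le> (\<mu> * x - 1)\<^sup>2 / (\<mu> * x)" using assms x by simp
    also have "\<dots> = \<mu> * x + 1 / x / \<mu> - 2"
      using assms x by (simp add: field_simps power2_eq_square)
    finally have "2 \<le> \<mu> * x + 1 / x / \<mu>" by simp
    then have "w * 2 \<le> w * (\<mu> * x + 1 / x / \<mu>)" by (rule mult_left_mono) (simp add: w_def)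
    then show "2 * w \<le> \<mu> * (w * x) + w * ((real k + 1) / y) powr (- q) / \<mu>"
      unfolding x(2) by (simp add: algebra_simps)
  qed
qed

lemma cosh_moment_le:
  obtains C where "0 < C" "\<And>z. 0 < z \<Longrightarrow> cosh_moment q z / (1 + z) powr q \<le> C * exp z"
proof -
  obtain n :: nat where n: "\<bar>q\<bar> \<le> real n" using real_arch_simple by blast
  define m :: real where "m = 2 * of_int (int n)"
  obtain K where
    K: "\<And>z. 0 < z \<Longrightarrow> within_factor K (cosh_moment m z / (1 + z) powr m) (exp z)"
    using cosh_moment_even_within_factor[of "int n"] by (auto simp: m_def)
  obtain L where
    L: "\<And>z. 0 < z \<Longrightarrow> within_factor L (cosh_moment (- m) z / (1 + z) powr (- m)) (exp z)"
    using cosh_moment_even_within_factor[of "- int n"] by (auto simp: m_def)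
  show ?thesis
  proof
    show "0 < K + L"
      using K[THEN within_factor_ge_1, of 1] L[THEN within_factor_ge_1, of 1] by simp
    fix z :: real assume z: "0 < z"
    have "cosh_moment q z / (1 + z) powr q
        \<le> cosh_moment m z / (1 + z) powr m + cosh_moment (- m) z / (1 + z) powr (- m)"
      using z n by (intro cosh_moment_interpolation) (auto simp: m_def)
    also have "\<dots> \<le> K * exp z + L * exp z"
      using K[OF z] L[OF z] unfolding within_factor_def by (intro add_mono) blast+
    finally show "cosh_moment q z / (1 + z) powr q \<le> (K + L) * exp z"
      by (simp add: distrib_right)
  qed
qed

lemma cosh_moment_within_factor:
  obtains K where "\<And>z. 0 < z \<Longrightarrow> within_factor K (cosh_moment q z) (exp z * (1 + z) powr q)"
proof -
  obtain C where C: "\<And>z. 0 < z \<Longrightarrow> cosh_moment q z / (1 + z) powr q \<le> C * exp z"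
    using cosh_moment_le by blast
  obtain B where B: "0 < B"
    "\<And>z. 0 < z \<Longrightarrow> cosh_moment (- q) z / (1 + z) powr (- q) \<le> B * exp z"
    using cosh_moment_le by blast
  have "within_factor (max C (4 * B)) (cosh_moment q z) (exp z * (1 + z) powr q)" if z: "0 < z" for z
  proof -
    define S where "S = cosh_moment q z / (1 + z) powr q"
    have moment: "cosh_moment q z = S * (1 + z) powr q" using z by (simp add: S_def)
    have "exp z \<le> 2 * cosh z" by (simp add: cosh_field_def)
    also have "\<dots> \<le> 2 * B * S + cosh_moment (- q) z / (1 + z) powr (- q) / (2 * B)"
      unfolding S_def using z B(1) by (intro two_cosh_le_cosh_moments) auto
    also have "\<dots> \<le> 2 * B * S + B * exp z / (2 * B)"
      using B(2)[OF z] B(1) by (intro add_left_mono divide_right_mono) auto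
    finally have lower: "exp z \<le> 4 * B * S" using B(1) by simp
    then have "0 < 4 * B * S" using exp_gt_zero[of z] by linarith
    then have "0 < S" using B(1) by (simp add: zero_less_mult_iff)
    have "within_factor (max C (4 * B)) S (exp z)"
      using C[OF z] lower \<open>0 < S\<close> unfolding S_def[symmetric] by (intro within_factor_maxI) auto
    from within_factor_mult_left[OF _ this, of "(1 + z) powr q"]
    show ?thesis using z by (simp add: moment mult.commute)
  qed
  then show ?thesis by (rule that)
qed

section \<open>The modified Bessel function\<close>

lemma Gamma_within_factor:
  fixes a :: real
  assumes "0 < a"
  obtains K where "\<And>k. within_factor K (Gamma (real k + a)) (fact k * (real k + 1) powr (a - 1))"
proof -
  define f where "f k = Gamma (real k + a) / (fact k * (real k + 1) powr (a - 1))" for k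
  have a: "a \<notin> \<int>\<^sub>\<le>\<^sub>0" "0 < Gamma a"
    using assms by (auto elim!: nonpos_Ints_cases)
  have "(\<lambda>n. Gamma a / Gamma_series a n * (real n powr a / ((real n + 1) * (real n + 2) powr (a - 1))))
      \<longlonglongrightarrow> Gamma a / Gamma a * 1"
  proof (intro tendsto_intros Gamma_series_LIMSEQ)
    show "(\<lambda>n. real n powr a / ((real n + 1) * (real n + 2) powr (a - 1))) \<longlonglongrightarrow> 1"
      by real_asymp
  qed (use a in auto)
  moreover have "\<forall>\<^sub>F n in sequentially.
      Gamma a / Gamma_series a n * (real n powr a / ((real n + 1) * (real n + 2) powr (a - 1)))
        = f (Suc n)"
    using eventually_gt_at_top[of 0]
  proof eventually_elim
    case (elim n)
    have "Gamma (real (Suc n) + a) = pochhammer a (Suc n) * Gamma a"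
      using pochhammer_Gamma[of a "Suc n"] a by (simp add: add.commute)
    moreover have "Gamma_series a n = fact n * real n powr a / pochhammer a (Suc n)"
      using elim by (simp add: Gamma_series_def powr_def mult.commute)
    ultimately show ?case using elim by (simp add: f_def add.commute mult_ac)
  qed
  ultimately have "(\<lambda>n. f (Suc n)) \<longlonglongrightarrow> 1"
    using a by (simp add: Lim_transform_eventually)
  then have "f \<longlonglongrightarrow> 1" by (simp only: filterlim_sequentially_Suc)
  then show ?thesis
    unfolding f_def by (rule within_factor_if_ratio_tendsto) (use assms that in auto)
qed

lemma bessel_coeff_within_factor:
  fixes \<nu> :: real
  assumes "-1 < \<nu>"
  obtains K where "\<And>k. within_factor K (1 / (4 ^ k * fact k * Gamma (real k + \<nu> + 1)))
    ((real k + 1) powr (- \<nu> - 1/2) / fact (2 * k))"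
proof -
  obtain K where K: "\<And>k. within_factor K (Gamma (real k + 1/2)) (fact k * (real k + 1) powr (1/2 - 1))"
    using Gamma_within_factor[of "1/2"] by auto
  obtain L where
    L: "\<And>k. within_factor L (Gamma (real k + (\<nu> + 1))) (fact k * (real k + 1) powr ((\<nu> + 1) - 1))"
    using assms Gamma_within_factor[of "\<nu> + 1"] by auto
  have "within_factor (sqrt pi * (K * L) * 1) (1 / (4 ^ k * fact k * Gamma (real k + \<nu> + 1)))
    ((real k + 1) powr (- \<nu> - 1/2) / fact (2 * k))" for k
  proof -
    let ?x = "real k + 1" and ?G = "\<lambda>a. Gamma (real k + a)"
    have "(1/2 :: real) \<notin> \<int>\<^sub>\<le>\<^sub>0" by (auto elim!: nonpos_Ints_cases)
    then have "fact (2 * k) = 4 ^ k * (?G (1/2) / sqrt pi) * fact k"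
      using pochhammer_Gamma[of "1/2::real" k]
      by (simp add: fact_double power_mult Gamma_one_half_real add.commute)
    moreover have "?G (1/2) \<noteq> 0" using Gamma_real_pos[of "real k + 1/2"] by linarith
    ultimately have
      "1 / (4 ^ k * fact k * ?G (\<nu> + 1)) = 1 / sqrt pi * (?G (1/2) / ?G (\<nu> + 1)) / fact (2 * k)"
      by simp
    moreover have "fact k * ?x powr (1/2 - 1) / (fact k * ?x powr (\<nu> + 1 - 1))
        = ?x powr (- \<nu> - 1/2)"
      by (simp add: powr_diff[symmetric] minus_diff_commute)
    moreover have "within_factor (sqrt pi) (1 / sqrt pi) 1"
      using pi_ge_two by (simp add: within_factor_def divide_simps)
    from within_factor_divide[OF within_factor_mult[OF this within_factor_divide[OF K[of k] L[of k]]]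
        within_factor_refl[of "fact (2 * k)" 1]]
    have "within_factor (sqrt pi * (K * L) * 1)
        (1 / sqrt pi * (?G (1/2) / ?G (\<nu> + 1)) / fact (2 * k))
        (1 * (fact k * ?x powr (1/2 - 1) / (fact k * ?x powr (\<nu> + 1 - 1))) / fact (2 * k))"
      by simp
    ultimately show ?thesis by (simp only: add.assoc mult_1_left)
  qed
  then show ?thesis by (rule that)
qed

lemma bessel_I_within_factor:
  fixes \<nu> :: real
  assumes "-1 < \<nu>"
  obtains K where "\<And>z. 0 < z \<Longrightarrow>
    within_factor K (bessel_I \<nu> z) ((z / 2) powr \<nu> * (exp z * (1 + z) powr (- \<nu> - 1/2)))"
proof -
  obtain K where K: "\<And>k. within_factor K (1 / (4 ^ k * fact k * Gamma (real k + \<nu> + 1)))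
      ((real k + 1) powr (- \<nu> - 1/2) / fact (2 * k))"
    using bessel_coeff_within_factor[OF assms] by blast
  obtain L where
    L: "\<And>z. 0 < z \<Longrightarrow>
      within_factor L (cosh_moment (- \<nu> - 1/2) z) (exp z * (1 + z) powr (- \<nu> - 1/2))"
    using cosh_moment_within_factor by blast
  have "within_factor (K * L) (bessel_I \<nu> z) ((z / 2) powr \<nu> * (exp z * (1 + z) powr (- \<nu> - 1/2)))"
    if z: "0 < z" for z
  proof -
    define b where "b k = z ^ (2 * k) * (1 / (4 ^ k * fact k * Gamma (real k + \<nu> + 1)))" for k
    have "within_factor K (b k) (z ^ (2 * k) * ((real k + 1) powr (- \<nu> - 1/2) / fact (2 * k)))" for k
      unfolding b_def using z by (intro within_factor_mult_left K) auto
    then have b: "within_factor K (b k) (z ^ (2 * k) / fact (2 * k) * (real k + 1) powr (- \<nu> - 1/2))"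
      for k by simp
    note b = within_factor_suminf[OF b summable_cosh_moment]
    have "(z / 2) powr (2 * real k + \<nu>) / (fact k * Gamma (real k + \<nu> + 1)) = (z / 2) powr \<nu> * b k"
      for k
    proof -
      have "(z / 2) powr (2 * real k) = z ^ (2 * k) / 4 ^ k"
        using z powr_realpow[of "z / 2" "2 * k"] by (simp add: power_divide power_mult)
      then show ?thesis by (simp add: powr_add b_def mult_ac)
    qed
    then have "bessel_I \<nu> z = (z / 2) powr \<nu> * suminf b"
      unfolding bessel_I_def using b(1) by (simp add: suminf_mult)
    moreover have "within_factor (K * L) (suminf b) (exp z * (1 + z) powr (- \<nu> - 1/2))"
      using b(2) L[OF z] unfolding cosh_moment_def by (rule within_factor_trans)
    ultimately show ?thesis using z by (simp add: within_factor_mult_left)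
  qed
  then show ?thesis by (rule that)
qed

section \<open>The Bessel heat kernel\<close>

definition heat_profile :: "real \<Rightarrow> real \<Rightarrow> real \<Rightarrow> real \<Rightarrow> real" where
  "heat_profile \<zeta> t r s =
     t powr (-1/2) * exp (- (r - s)\<^sup>2 / (4 * t)) / (r * s + t) powr \<zeta>"

lemma bessel_heat_prefactor:
  fixes r s t :: real
  assumes "0 < r" "0 < s" "0 < t"
  defines "z \<equiv> r * s / (2 * t)"
  shows "(r * s) powr (1/2 - \<zeta>) / (2 * t) * exp (- (r\<^sup>2 + s\<^sup>2) / (4 * t))
      * ((z / 2) powr (\<zeta> - 1/2) * (exp z * (1 + z) powr (- \<zeta>)))
    = t powr (-1/2) * exp (- (r - s)\<^sup>2 / (4 * t)) * (2 * (r * s) + 4 * t) powr (- \<zeta>)"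
proof -
  have z: "0 < z" using assms by simp
  have "- (r\<^sup>2 + s\<^sup>2) / (4 * t) + z = - (r - s)\<^sup>2 / (4 * t)"
    using assms by (simp add: field_simps power2_eq_square)
  then have exponents: "exp (- (r\<^sup>2 + s\<^sup>2) / (4 * t)) * exp z = exp (- (r - s)\<^sup>2 / (4 * t))"
    by (simp only: exp_add[symmetric])
  have "r * s = 4 * t * (z / 2)" using assms by simp
  then have rs_powr: "(r * s) powr (1/2 - \<zeta>) = (4 * t) powr (1/2 - \<zeta>) * (z / 2) powr (1/2 - \<zeta>)"
    by (simp only: powr_mult)
  have z_powr: "(z / 2) powr (1/2 - \<zeta>) * (z / 2) powr (\<zeta> - 1/2) = 1"
    using z by (simp add: powr_add[symmetric])
  have "2 * (r * s) + 4 * t = 4 * t * (1 + z)" using assms by (simp add: field_simps)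
  then have sum_powr: "(2 * (r * s) + 4 * t) powr (- \<zeta>) = (4 * t) powr (- \<zeta>) * (1 + z) powr (- \<zeta>)"
    by (simp only: powr_mult)
  have t_powr: "(4 * t) powr (1/2 - \<zeta>) / (2 * t) = t powr (-1/2) * (4 * t) powr (- \<zeta>)"
  proof -
    have "(4 * t) powr (1/2 - \<zeta>) = (4 * t) powr (1/2) * (4 * t) powr (- \<zeta>)"
      by (simp add: powr_add[symmetric])
    moreover have "(4 * t) powr (1/2) / (2 * t) = t powr (-1/2)"
      using assms powr_diff[of t "1/2" 1] by (simp add: powr_mult powr_half_sqrt[of 4])
    ultimately show ?thesis by (metis times_divide_eq_left)
  qed
  have "(r * s) powr (1/2 - \<zeta>) / (2 * t) * exp (- (r\<^sup>2 + s\<^sup>2) / (4 * t))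
      * ((z / 2) powr (\<zeta> - 1/2) * (exp z * (1 + z) powr (- \<zeta>)))
    = (4 * t) powr (1/2 - \<zeta>) / (2 * t) * ((z / 2) powr (1/2 - \<zeta>) * (z / 2) powr (\<zeta> - 1/2))
      * (exp (- (r\<^sup>2 + s\<^sup>2) / (4 * t)) * exp z) * (1 + z) powr (- \<zeta>)"
    unfolding rs_powr by (simp only: times_divide_eq_left times_divide_eq_right mult_ac)
  also have "\<dots> = t powr (-1/2) * exp (- (r - s)\<^sup>2 / (4 * t)) * (2 * (r * s) + 4 * t) powr (- \<zeta>)"
    unfolding z_powr exponents t_powr sum_powr by (simp only: mult_1_right mult_ac)
  finally show ?thesis .
qed

lemma bessel_heat_within_factor:
  assumes "-1/2 < \<zeta>"
  obtains K where
    "\<And>r s t. 0 < r \<Longrightarrow> 0 < s \<Longrightarrow> 0 < t \<Longrightarrow>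
      within_factor K (bessel_heat \<zeta> t r s) (heat_profile \<zeta> t r s)"
proof -
  obtain K where K: "\<And>z. 0 < z \<Longrightarrow> within_factor K (bessel_I (\<zeta> - 1/2) z)
      ((z / 2) powr (\<zeta> - 1/2) * (exp z * (1 + z) powr (- (\<zeta> - 1/2) - 1/2)))"
    using assms bessel_I_within_factor[of "\<zeta> - 1/2"] by auto
  have "within_factor (K * 4 powr \<bar>- \<zeta>\<bar>) (bessel_heat \<zeta> t r s) (heat_profile \<zeta> t r s)"
    if pos: "0 < r" "0 < s" "0 < t" for r s t
  proof -
    let ?E = "t powr (-1/2) * exp (- (r - s)\<^sup>2 / (4 * t))"
    have "within_factor K (bessel_heat \<zeta> t r s) (?E * (2 * (r * s) + 4 * t) powr (- \<zeta>))"
      using pos K[of "r * s / (2 * t)"]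
      unfolding bessel_heat_def bessel_heat_prefactor[OF pos, symmetric]
      by (intro within_factor_mult_left) auto
    also have "within_factor (4 powr \<bar>- \<zeta>\<bar>)
        (?E * (2 * (r * s) + 4 * t) powr (- \<zeta>)) (?E * (r * s + t) powr (- \<zeta>))"
    proof (intro within_factor_mult_left within_factor_powr)
      have "0 < r * s" using pos by simp
      then show "within_factor 4 (2 * (r * s) + 4 * t) (r * s + t)"
        using pos by (simp add: within_factor_def add_pos_pos)
    qed (use pos in simp)
    also have "?E * (r * s + t) powr (- \<zeta>) = heat_profile \<zeta> t r s"
      by (simp add: heat_profile_def powr_minus_divide)
    finally show ?thesis .
  qed
  then show ?thesis by (rule that)
qed

lemma one_plus_powr_le_exp_square:
  fixes x p \<epsilon> :: real
  assumes "0 \<le> x" "0 \<le> p" "0 < \<epsilon>"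
  shows "(1 + x) powr p \<le> exp (p\<^sup>2 / (4 * \<epsilon>)) * exp (\<epsilon> * x\<^sup>2)"
proof -
  have "(1 + x) powr p \<le> exp x powr p"
    using assms by (intro powr_mono2) auto
  also have "\<dots> = exp (p * x)" by (simp add: powr_def)
  also have "\<dots> \<le> exp (p\<^sup>2 / (4 * \<epsilon>) + \<epsilon> * x\<^sup>2)"
  proof -
    have "0 \<le> \<epsilon> * (x - p / (2 * \<epsilon>))\<^sup>2" using assms by simp
    also have "\<dots> = p\<^sup>2 / (4 * \<epsilon>) + \<epsilon> * x\<^sup>2 - p * x"
      using assms by (simp add: power2_eq_square field_simps)
    finally show ?thesis by simp
  qed
  finally show ?thesis by (simp add: exp_add)
qed

lemma max_product_le:
  fixes r s q :: real
  assumes "0 \<le> r" "0 \<le> s" "0 \<le> q"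
  shows "max r q * max s q \<le> r * s + q\<^sup>2 + q * \<bar>r - s\<bar>"
proof -
  have mixed: "x * q \<le> y * x + q\<^sup>2 + q * \<bar>x - y\<bar>" if "0 \<le> x" "0 \<le> y" "q \<le> x" "y \<le> q" for x y
  proof -
    have "q * y \<le> q * q" using assms that by (intro mult_left_mono)
    moreover have "q * \<bar>x - y\<bar> = q * x - q * y" using that by (simp add: right_diff_distrib)
    moreover have "0 \<le> y * x" using that by simp
    ultimately show ?thesis by (simp add: power2_eq_square mult.commute)
  qed
  show ?thesis
  proof (cases "q \<le> r"; cases "q \<le> s")
    assume "q \<le> r" "\<not> q \<le> s"
    then show ?thesis using mixed[of r s] assms by (simp add: max_def mult.commute)
  next
    assume "\<not> q \<le> r" "q \<le> s"
    then show ?thesis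
      using mixed[of s r] assms by (simp add: max_def mult.commute abs_minus_commute)
  qed (use assms in \<open>simp_all add: max_def power2_eq_square\<close>)
qed

lemma max_product_within_factor:
  fixes r s q :: real
  assumes "0 < r" "0 < s" "0 < q"
  shows "within_factor (2 * (1 + \<bar>r - s\<bar> / q)) (max r q * max s q) (r * s + q\<^sup>2)"
proof -
  define d where "d = \<bar>r - s\<bar> / q"
  have d: "0 \<le> d" and rs: "0 < r * s" using assms by (simp_all add: d_def)
  have "q * \<bar>r - s\<bar> = d * q\<^sup>2" using assms by (simp add: d_def power2_eq_square)
  then have "max r q * max s q \<le> r * s + q\<^sup>2 + d * q\<^sup>2"
    using max_product_le[of r s q] assms by simp
  moreover have "d * q\<^sup>2 \<le> d * (r * s + q\<^sup>2)" "0 \<le> (1 + d) * (r * s + q\<^sup>2)"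
    using d rs by (auto intro: mult_left_mono)
  ultimately have upper: "max r q * max s q \<le> 2 * (1 + d) * (r * s + q\<^sup>2)"
    by (simp add: algebra_simps)
  have "r * s \<le> max r q * max s q" "q\<^sup>2 \<le> max r q * max s q"
    using assms by (auto simp: power2_eq_square intro!: mult_mono)
  moreover have "0 \<le> d * (max r q * max s q)" using d assms by simp
  ultimately have "r * s + q\<^sup>2 \<le> 2 * (1 + d) * (max r q * max s q)"
    by (simp add: algebra_simps)
  moreover have "0 < max r q * max s q" using assms by (simp add: less_max_iff_disj)
  ultimately show ?thesis
    using upper rs by (simp add: within_factor_def d_def add_pos_nonneg)
qed

lemma A_zeta_eq:
  assumes "0 < r" "0 < s" "0 < t"
  shows "A_zeta \<zeta> t r s = t powr (-1/2) * (max r (sqrt t) * max s (sqrt t)) powr (- \<zeta>)"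
proof -
  have "min 1 (x / sqrt t) = x / max x (sqrt t)" if "0 < x" for x
    using assms that by (auto simp: min_def max_def field_simps)
  note min_eq = this[OF assms(1)] this[OF assms(2)]
  have "A_zeta \<zeta> t r s = t powr (-1/2)
      * (r / max r (sqrt t) * (s / max s (sqrt t)) * (1 / (r * s))) powr \<zeta>"
    unfolding A_zeta_def min_eq powr_mult by (rule mult.commute)
  also have "r / max r (sqrt t) * (s / max s (sqrt t)) * (1 / (r * s))
      = 1 / (max r (sqrt t) * max s (sqrt t))"
    using assms by simp
  finally show ?thesis by (simp add: powr_minus_divide powr_divide)
qed

lemma A_zeta_within_factor:
  assumes "0 < r" "0 < s" "0 < t"
  shows "within_factor (2 powr \<bar>\<zeta>\<bar> * exp (2 * \<zeta>\<^sup>2) * exp ((r - s)\<^sup>2 / (8 * t)))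
    (A_zeta \<zeta> t r s) (t powr (-1/2) / (r * s + t) powr \<zeta>)"
proof -
  define x where "x = \<bar>r - s\<bar> / sqrt t"
  have "within_factor ((2 * (1 + x)) powr \<bar>- \<zeta>\<bar>)
      ((max r (sqrt t) * max s (sqrt t)) powr (- \<zeta>)) ((r * s + (sqrt t)\<^sup>2) powr (- \<zeta>))"
    unfolding x_def using assms by (intro within_factor_powr max_product_within_factor) auto
  from within_factor_mult_left[OF _ this, of "t powr (-1/2)"]
  have "within_factor ((2 * (1 + x)) powr \<bar>\<zeta>\<bar>)
      (A_zeta \<zeta> t r s) (t powr (-1/2) / (r * s + t) powr \<zeta>)"
    unfolding A_zeta_eq[OF assms] using assms by (simp add: powr_minus_divide)
  then show ?thesis
  proof (rule within_factor_mono)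
    have "(2 * (1 + x)) powr \<bar>\<zeta>\<bar> = 2 powr \<bar>\<zeta>\<bar> * (1 + x) powr \<bar>\<zeta>\<bar>"
      by (rule powr_mult)
    also have "\<dots> \<le> 2 powr \<bar>\<zeta>\<bar> * (exp (\<bar>\<zeta>\<bar>\<^sup>2 / (4 * (1/8))) * exp (1/8 * x\<^sup>2))"
      using assms by (intro mult_left_mono one_plus_powr_le_exp_square) (auto simp: x_def)
    also have "x\<^sup>2 = (r - s)\<^sup>2 / t" using assms by (simp add: x_def power_divide)
    finally show "(2 * (1 + x)) powr \<bar>\<zeta>\<bar>
        \<le> 2 powr \<bar>\<zeta>\<bar> * exp (2 * \<zeta>\<^sup>2) * exp ((r - s)\<^sup>2 / (8 * t))"
      by (simp add: mult_ac)
  qed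
qed

lemma heat_profile_A_zeta_bounds:
  fixes \<zeta> r s t :: real
  assumes "0 < r" "0 < s" "0 < t"
  defines "C \<equiv> 2 powr \<bar>\<zeta>\<bar> * exp (2 * \<zeta>\<^sup>2)"
  shows "A_zeta \<zeta> t r s * exp (- (r - s)\<^sup>2 / (8/3 * t)) \<le> C * heat_profile \<zeta> t r s"
    and "heat_profile \<zeta> t r s \<le> C * (A_zeta \<zeta> t r s * exp (- (r - s)\<^sup>2 / (8 * t)))"
proof -
  define x where "x = (r - s)\<^sup>2 / (8 * t)"
  define G where "G = t powr (-1/2) / (r * s + t) powr \<zeta>"
  let ?A = "A_zeta \<zeta> t r s"
  have le: "?A \<le> C * exp x * G" "G \<le> C * exp x * ?A"
    using A_zeta_within_factor[OF assms(1-3), of \<zeta>]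
    unfolding within_factor_def C_def G_def x_def by blast+
  have profile: "heat_profile \<zeta> t r s = G * exp (- (2 * x))"
    by (simp add: heat_profile_def G_def x_def)
  have "?A * exp (- (3 * x)) \<le> C * exp x * G * exp (- (3 * x))"
    using le(1) by (rule mult_right_mono) simp
  also have "\<dots> = C * heat_profile \<zeta> t r s"
    unfolding profile using exp_add[of x "- (3 * x)"] by (simp add: mult_ac)
  also have "- (3 * x) = - (r - s)\<^sup>2 / (8/3 * t)" by (simp add: x_def)
  finally show "?A * exp (- (r - s)\<^sup>2 / (8/3 * t)) \<le> C * heat_profile \<zeta> t r s" .
  have "heat_profile \<zeta> t r s \<le> C * exp x * ?A * exp (- (2 * x))"
    unfolding profile using le(2) by (rule mult_right_mono) simp
  also have "\<dots> = C * (?A * exp (- x))"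
    using exp_add[of x "- (2 * x)"] by (simp add: mult_ac)
  also have "- x = - (r - s)\<^sup>2 / (8 * t)" by (simp add: x_def)
  finally show "heat_profile \<zeta> t r s \<le> C * (?A * exp (- (r - s)\<^sup>2 / (8 * t)))" .
qed

section \<open>The profile of the subordinated kernel\<close>

definition jump_scale :: "real \<Rightarrow> real \<Rightarrow> real \<Rightarrow> real \<Rightarrow> real" where
  "jump_scale \<alpha> t r s = max \<bar>r - s\<bar> (t powr (1 / \<alpha>))"

definition heat_amplitude :: "real \<Rightarrow> real \<Rightarrow> real \<Rightarrow> real \<Rightarrow> real" where
  "heat_amplitude \<zeta> D r s = 1 / D * (r * s + D\<^sup>2) powr (- \<zeta>)"

text \<open>At time \<open>t\<close> the subordinator exceeds \<open>D\<^sup>2\<close> with a probability of order \<open>t / D powr \<alpha>\<close>.\<close>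

definition jump_profile :: "real \<Rightarrow> real \<Rightarrow> real \<Rightarrow> real \<Rightarrow> real \<Rightarrow> real" where
  "jump_profile \<zeta> \<alpha> t r s =
     t / jump_scale \<alpha> t r s powr \<alpha> * heat_amplitude \<zeta> (jump_scale \<alpha> t r s) r s"

lemma jump_scale_pos: "0 < t \<Longrightarrow> 0 < jump_scale \<alpha> t r s"
  by (simp add: jump_scale_def less_max_iff_disj)

lemma square_sum_within_factor:
  fixes r s T :: real
  assumes "0 < r" "0 < s" "0 < T"
  shows "within_factor 8 ((T + (r + s))\<^sup>2) (r * s + (max \<bar>r - s\<bar> T)\<^sup>2)"
proof -
  define D where "D = max \<bar>r - s\<bar> T"
  have rs: "0 < r * s" and D: "0 < D" "\<bar>r - s\<bar> \<le> D" "T \<le> D" "D \<le> T + (r + s)"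
    using assms by (auto simp: D_def)
  have sum_sq: "(r + s)\<^sup>2 = (r - s)\<^sup>2 + 4 * (r * s)"
    by (simp add: power2_eq_square algebra_simps)
  have "(r - s)\<^sup>2 \<le> D\<^sup>2" "T\<^sup>2 \<le> D\<^sup>2"
    using D assms by (auto simp: abs_le_square_iff[symmetric])
  moreover have "(T + (r + s))\<^sup>2 \<le> 2 * T\<^sup>2 + 2 * (r + s)\<^sup>2"
    using sum_squares_bound[of T "r + s"] power2_sum[of T "r + s"] by linarith
  moreover have "4 * D\<^sup>2 \<le> 8 * D\<^sup>2" by simp
  ultimately have "(T + (r + s))\<^sup>2 \<le> 8 * (r * s + D\<^sup>2)"
    unfolding sum_sq distrib_left by linarith
  moreover have "r * s + D\<^sup>2 \<le> 8 * (T + (r + s))\<^sup>2"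
  proof -
    have "D\<^sup>2 \<le> (T + (r + s))\<^sup>2" using D by (intro power_mono) auto
    moreover have "4 * (r * s) \<le> (r + s)\<^sup>2" unfolding sum_sq by simp
    moreover have "(r + s)\<^sup>2 \<le> (T + (r + s))\<^sup>2" using assms by (intro power_mono) auto
    ultimately show ?thesis using rs by simp
  qed
  ultimately show ?thesis
    using rs assms by (simp add: within_factor_def D_def[symmetric] add_pos_nonneg)
qed

lemma two_scale_le:
  fixes d b T p q :: real
  assumes "0 \<le> d" "d \<le> b" "0 < b" "0 < T" "0 \<le> p" "0 \<le> p + q"
  shows "d powr p * b powr q \<le> 2 powr \<bar>q\<bar> * (max d T powr p * (T + b) powr q)"
proof -
  have near: "x powr q \<le> 2 powr \<bar>q\<bar> * (T + b) powr q" if "0 < x" "x \<le> T + b" "T + b \<le> 2 * x" for x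
    using powr_within_factor_2[OF that] by (auto simp: within_factor_def)
  have "d powr p * b powr q \<le> max d T powr p * (2 powr \<bar>q\<bar> * (T + b) powr q)"
  proof (cases "T \<le> b")
    case True
    then show ?thesis using assms by (intro mult_mono powr_mono2 near) auto
  next
    case False
    have "d powr p * b powr q \<le> b powr p * b powr q"
      using assms by (intro mult_right_mono powr_mono2) auto
    also have "\<dots> = b powr (p + q)" by (simp add: powr_add)
    also have "\<dots> \<le> T powr (p + q)"
      using False assms by (intro powr_mono2) auto
    also have "\<dots> = T powr p * T powr q" by (simp add: powr_add)
    also have "\<dots> \<le> max d T powr p * (2 powr \<bar>q\<bar> * (T + b) powr q)"
      using False assms by (intro mult_mono powr_mono2 near) auto
    finally show ?thesis .
  qed
  then show ?thesis by (simp add: mult_ac)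
qed

lemma two_scale_within_factor:
  fixes d b T p q :: real
  assumes "0 \<le> d" "d \<le> b" "0 < b" "0 < T" "0 \<le> p" "0 \<le> p + q"
  shows "within_factor (1 + 2 powr \<bar>q\<bar>)
    (d powr p * b powr q + T powr p * (T + b) powr q) (max d T powr p * (T + b) powr q)"
proof -
  define k where "k = (2::real) powr \<bar>q\<bar>"
  have k: "1 \<le> k" by (simp add: k_def ge_one_powr_ge_zero)
  let ?X = "d powr p * b powr q" and ?Y = "T powr p * (T + b) powr q"
    and ?M = "max d T powr p * (T + b) powr q"
  have "?X \<le> k * ?M" unfolding k_def using assms by (rule two_scale_le)
  moreover have "?Y \<le> ?M" using assms by (intro mult_right_mono powr_mono2) auto
  ultimately have "?X + ?Y \<le> (1 + k) * ?M" by (simp add: distrib_right)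
  have "?M \<le> k * ?X + ?Y"
  proof (cases "d \<le> T")
    case True
    then show ?thesis using k by (simp add: max_def)
  next
    case False
    then have "(T + b) powr q \<le> k * b powr q"
      using assms powr_within_factor_2[of b "T + b" q] by (simp add: within_factor_def k_def)
    then have "?M \<le> d powr p * (k * b powr q)"
      using False by (simp add: max_def mult_left_mono)
    then show ?thesis by (simp add: mult_ac add_increasing2)
  qed
  also have "\<dots> \<le> (k * ?X + ?Y) + (?X + k * ?Y)" using k by simp
  also have "\<dots> = (1 + k) * (?X + ?Y)" by (simp add: algebra_simps)
  finally have "?M \<le> (1 + k) * (?X + ?Y)" .
  moreover have "0 < ?Y" "0 \<le> ?X" "0 < ?M" using assms by (auto simp: less_max_iff_disj)
  ultimately show ?thesis
    using \<open>?X + ?Y \<le> (1 + k) * ?M\<close> by (simp add: within_factor_def k_def add_nonneg_pos)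
qed

lemma Q_bound_within_factor:
  assumes "-1/2 < \<zeta>" "0 < \<alpha>" "0 < r" "0 < s" "0 < t"
  shows "within_factor ((1 + 2 powr \<bar>2 * \<zeta>\<bar>) * 8 powr \<bar>\<zeta>\<bar>)
    (Q_bound \<zeta> \<alpha> t r s) (jump_profile \<zeta> \<alpha> t r s)"
proof -
  define T where "T = t powr (1 / \<alpha>)"
  define D where "D = jump_scale \<alpha> t r s"
  have T: "0 < T" "t powr ((1 + \<alpha>) / \<alpha>) = T powr (1 + \<alpha>)"
    using assms by (simp_all add: T_def powr_powr)
  have D: "D = max \<bar>r - s\<bar> T" "0 < D"
    using T by (simp_all add: D_def T_def jump_scale_def less_max_iff_disj)
  have profile: "jump_profile \<zeta> \<alpha> t r s = t * inverse (D powr (1 + \<alpha>) * (r * s + D\<^sup>2) powr \<zeta>)"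
    using D(2)
    by (simp add: jump_profile_def heat_amplitude_def D_def powr_add powr_minus divide_inverse)
  have "within_factor (1 + 2 powr \<bar>2 * \<zeta>\<bar>)
      (\<bar>r - s\<bar> powr (1 + \<alpha>) * (r + s) powr (2 * \<zeta>) + T powr (1 + \<alpha>) * (T + (r + s)) powr (2 * \<zeta>))
      (D powr (1 + \<alpha>) * (T + (r + s)) powr (2 * \<zeta>))"
    unfolding D using assms T by (intro two_scale_within_factor) auto
  also have "D powr (1 + \<alpha>) * (T + (r + s)) powr (2 * \<zeta>)
      = D powr (1 + \<alpha>) * ((T + (r + s))\<^sup>2) powr \<zeta>"
    using assms T by (simp add: powr_powr[symmetric])
  also have "within_factor (8 powr \<bar>\<zeta>\<bar>) (D powr (1 + \<alpha>) * ((T + (r + s))\<^sup>2) powr \<zeta>)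
      (D powr (1 + \<alpha>) * (r * s + D\<^sup>2) powr \<zeta>)"
    using assms T D(2) unfolding D(1)
    by (intro within_factor_mult_left within_factor_powr square_sum_within_factor) auto
  finally have "within_factor ((1 + 2 powr \<bar>2 * \<zeta>\<bar>) * 8 powr \<bar>\<zeta>\<bar>)
      (\<bar>r - s\<bar> powr (1 + \<alpha>) * (r + s) powr (2 * \<zeta>) + T powr (1 + \<alpha>) * (T + (r + s)) powr (2 * \<zeta>))
      (D powr (1 + \<alpha>) * (r * s + D\<^sup>2) powr \<zeta>)" .
  from within_factor_mult_left[OF assms(5) within_factor_inverse[OF this]]
  show ?thesis
    unfolding Q_bound_def profile T(2) T_def[symmetric] by (simp add: divide_inverse add.assoc)
qed

section \<open>Stable laws\<close>

lemma min_1_le_one_minus_exp: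
  fixes u :: real
  assumes "0 \<le> u"
  shows "min 1 u \<le> 2 * (1 - exp (- u))"
proof -
  have exp_le: "exp (- u) \<le> 1 / (1 + u)"
    using exp_ge_add_one_self[of u] assms by (simp add: exp_minus field_simps)
  have "min 1 u \<le> 2 * (1 - 1 / (1 + u))"
  proof (cases "u \<le> 1")
    case True
    then have "u * u \<le> 1 * u" using assms by (intro mult_right_mono) auto
    then show ?thesis using True assms by (simp add: min_def field_simps)
  qed (simp add: min_def field_simps)
  also have "\<dots> \<le> 2 * (1 - exp (- u))" using exp_le by simp
  finally show ?thesis .
qed

lemma one_minus_exp_le: "1 - exp (- u) \<le> (u :: real)"
  using exp_ge_add_one_self[of "- u"] by simp

definition window :: "real \<Rightarrow> real \<Rightarrow> real \<Rightarrow> real" where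
  "window a A u = (1 - exp (- u)) - 2 * a * (1 - exp (- (u / a))) - 2 * (1 - exp (- (u / A)))"

lemma window_le_indicator:
  assumes "0 < a" "0 < A" "0 < u"
  shows "window a A u \<le> indicator {a..A} u"
proof -
  define X where "X = 2 * a * (1 - exp (- (u / a)))"
  define Y where "Y = 2 * (1 - exp (- (u / A)))"
  have XY: "0 \<le> X" "0 \<le> Y" using assms by (auto simp: X_def Y_def)
  have window: "window a A u = (1 - exp (- u)) - X - Y" by (simp add: window_def X_def Y_def)
  consider "u \<in> {a..A}" | "u < a" | "A < u" by force
  then show ?thesis
  proof cases
    case 1
    have "window a A u \<le> 1" using XY exp_gt_zero[of "- u"] unfolding window by linarith
    then show ?thesis using 1 by simp
  next
    case 2
    have "a * min 1 (u / a) \<le> a * (2 * (1 - exp (- (u / a))))"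
      using assms by (intro mult_left_mono min_1_le_one_minus_exp) auto
    then have "u \<le> X" using 2 assms by (simp add: X_def algebra_simps)
    then show ?thesis using 2 XY one_minus_exp_le[of u] by (simp add: window)
  next
    case 3
    have "1 \<le> Y" using min_1_le_one_minus_exp[of "u / A"] 3 assms by (simp add: Y_def)
    then have "window a A u \<le> 0" using XY exp_gt_zero[of "- u"] unfolding window by linarith
    then show ?thesis using 3 by simp
  qed
qed

lemma summable_powr_exp_powr:
  fixes p c \<beta> :: real
  assumes "0 < c" "0 < \<beta>"
  shows "summable (\<lambda>n. (real n + 1) powr p * exp (- (c * real n powr \<beta>)))"
proof -
  have "(\<lambda>n. (real n + 1) powr p * exp (- (c * real n powr \<beta>))) \<in> O(\<lambda>n. real n powr (- 2))"
    using assms by real_asymp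
  then show ?thesis
    by (rule summable_comparison_test_bigo[rotated]) (simp add: summable_real_powr_iff)
qed

lemma summable_powr_exp:
  fixes p u :: real
  assumes "0 < u"
  shows "summable (\<lambda>n. (real n + 1) powr p * exp (- (real n * u)))"
  using summable_powr_exp_powr[of u 1 p] assms by (simp add: mult.commute)

lemma min_1_powr_le_exp_series:
  fixes p u :: real
  assumes "0 < u" "0 \<le> p"
  shows "min 1 u powr (- p) \<le> exp 1 * (\<Sum>n. (real n + 1) powr p * exp (- (real n * u)))"
proof -
  define n where "n = nat \<lfloor>1 / u\<rfloor>"
  have n: "real n \<le> 1 / u" "1 / u \<le> real n + 1"
    using assms by (auto simp: n_def)
  then have nu: "real n * u \<le> 1" "1 / min 1 u \<le> real n + 1"
    using assms by (auto simp: field_simps min_def)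
  have "min 1 u powr (- p) = (1 / min 1 u) powr p"
    using assms by (simp add: powr_minus_divide powr_divide)
  also have "\<dots> \<le> (real n + 1) powr p"
    using nu(2) assms by (intro powr_mono2) auto
  also have "\<dots> = exp 1 * ((real n + 1) powr p * exp (- 1))" by (simp add: exp_minus)
  also have "\<dots> \<le> exp 1 * ((real n + 1) powr p * exp (- (real n * u)))"
    using nu(1) by (intro mult_left_mono) auto
  also have "\<dots> \<le> exp 1 * (\<Sum>n. (real n + 1) powr p * exp (- (real n * u)))"
    using sum_le_suminf[OF summable_powr_exp[OF assms(1)], of "{n}" p] by (intro mult_left_mono) auto
  finally show ?thesis .
qed

text \<open>With these endpoints, the last two terms of the window have integrals at most \<open>\<epsilon> / 8\<close> against a stable
  law, while the integral of the first term is at least \<open>\<epsilon> / 2\<close>.\<close>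

definition window_left :: "real \<Rightarrow> real" where
  "window_left \<beta> = (1 / 16) powr (1 / (1 - \<beta>))"

definition window_right :: "real \<Rightarrow> real" where
  "window_right \<beta> = 16 powr (1 / \<beta>)"

lemma window_left_powr:
  assumes "\<beta> < 1"
  shows "window_left \<beta> * (1 / window_left \<beta>) powr \<beta> = 1/16"
proof -
  have "window_left \<beta> powr (1 - \<beta>) = 1/16" using assms by (simp add: window_left_def powr_powr)
  moreover have "0 < window_left \<beta>" by (simp add: window_left_def)
  ultimately show ?thesis by (simp add: powr_divide powr_diff)
qed

lemma window_right_powr:
  assumes "0 < \<beta>"
  shows "(1 / window_right \<beta>) powr \<beta> = 1/16"
proof -
  have "window_right \<beta> powr \<beta> = 16" using assms by (simp add: window_right_def powr_powr)
  then show ?thesis by (simp add: powr_divide)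
qed

definition negative_moment_bound :: "real \<Rightarrow> real \<Rightarrow> real \<Rightarrow> real" where
  "negative_moment_bound p \<beta> \<epsilon> =
     exp 1 * (\<Sum>n. (real n + 1) powr p * exp (- (\<epsilon> * real n powr \<beta>)))"

locale stable_law =
  fixes \<nu> :: "real measure" and \<beta> \<epsilon> :: real
  assumes sets_borel [measurable_cong]: "sets \<nu> = sets borel"
    and AE_pos: "AE u in \<nu>. 0 < u"
    and laplace: "0 \<le> l \<Longrightarrow> has_bochner_integral \<nu> (\<lambda>u. exp (- (l * u))) (exp (- (\<epsilon> * l powr \<beta>)))"
    and \<epsilon>_pos: "0 < \<epsilon>" and \<beta>_pos: "0 < \<beta>"
begin

lemma
  assumes h: "h \<in> borel_measurable borel" and g: "integrable \<nu> g"
    and nonneg: "\<And>u. 0 < u \<Longrightarrow> 0 \<le> h u" and le: "\<And>u. 0 < u \<Longrightarrow> h u \<le> (g u :: real)"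
  shows integrable_dominated: "integrable \<nu> h"
    and integral_dominated: "(\<integral>u. h u \<partial>\<nu>) \<le> (\<integral>u. g u \<partial>\<nu>)"
proof -
  have [measurable]: "h \<in> borel_measurable \<nu>" using h by measurable
  show int: "integrable \<nu> h"
  proof (rule Bochner_Integration.integrable_bound[OF g])
    show "AE u in \<nu>. norm (h u) \<le> norm (g u)"
      using AE_pos by eventually_elim (use nonneg le in force)
  qed measurable
  show "(\<integral>u. h u \<partial>\<nu>) \<le> (\<integral>u. g u \<partial>\<nu>)"
    using AE_pos by (intro integral_mono_AE int g) (auto elim!: eventually_mono intro: le)
qed

lemma has_integral_one_minus_exp:
  assumes "0 \<le> l"
  shows "has_bochner_integral \<nu> (\<lambda>u. 1 - exp (- (l * u))) (1 - exp (- (\<epsilon> * l powr \<beta>)))"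
  using has_bochner_integral_diff[OF laplace[of 0] laplace[OF assms]] by simp

lemma
  assumes h: "h \<in> borel_measurable borel"
    and nonneg: "\<And>u. 0 < u \<Longrightarrow> 0 \<le> h u" and le: "\<And>u. 0 < u \<Longrightarrow> h u \<le> C * min 1 u" and C: "0 \<le> C"
  shows integrable_if_le_min_1: "integrable \<nu> h"
    and integral_le_if_le_min_1: "(\<integral>u. h u \<partial>\<nu>) \<le> 2 * C * \<epsilon>"
proof -
  let ?g = "\<lambda>u. 2 * C * (1 - exp (- (1 * u)))"
  have "has_bochner_integral \<nu> ?g (2 * C * (1 - exp (- (\<epsilon> * 1 powr \<beta>))))"
    by (intro has_bochner_integral_mult_right has_integral_one_minus_exp) simp
  then have g: "integrable \<nu> ?g" "(\<integral>u. ?g u \<partial>\<nu>) = 2 * C * (1 - exp (- (\<epsilon> * 1 powr \<beta>)))"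
    unfolding has_bochner_integral_iff by blast+
  have hg: "h u \<le> ?g u" if "0 < u" for u
    using le[OF that] mult_left_mono[OF min_1_le_one_minus_exp C, of u] that
    by (simp add: algebra_simps)
  show "integrable \<nu> h"
    by (rule integrable_dominated[OF h g(1) nonneg hg])
  have "(\<integral>u. h u \<partial>\<nu>) \<le> (\<integral>u. ?g u \<partial>\<nu>)"
    by (rule integral_dominated[OF h g(1) nonneg hg])
  also have "\<dots> = 2 * C * (1 - exp (- \<epsilon>))" unfolding g(2) by simp
  also have "\<dots> \<le> 2 * C * \<epsilon>"
    using C by (intro mult_left_mono one_minus_exp_le) auto
  finally show "(\<integral>u. h u \<partial>\<nu>) \<le> 2 * C * \<epsilon>" .
qed

lemma exp_series_integral:
  fixes p :: real
  defines "g \<equiv> \<lambda>u. \<Sum>n. (real n + 1) powr p * exp (- (real n * u))"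
  shows "integrable \<nu> g" "exp 1 * (\<integral>u. g u \<partial>\<nu>) = negative_moment_bound p \<beta> \<epsilon>"
proof -
  let ?c = "\<lambda>n. (real n + 1) powr p * exp (- (\<epsilon> * real n powr \<beta>))"
  have "has_bochner_integral \<nu> (\<lambda>u. (real n + 1) powr p * exp (- (real n * u))) (?c n)" for n
    by (intro has_bochner_integral_mult_right laplace) simp
  then have int: "integrable \<nu> (\<lambda>u. (real n + 1) powr p * exp (- (real n * u)))"
    and eq: "(\<integral>u. (real n + 1) powr p * exp (- (real n * u)) \<partial>\<nu>) = ?c n" for n
    by (auto simp: has_bochner_integral_iff)
  have AE_summable: "AE u in \<nu>. summable (\<lambda>n. norm ((real n + 1) powr p * exp (- (real n * u))))"
    using AE_pos by eventually_elim (simp add: summable_powr_exp)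
  have sum_int: "summable (\<lambda>n. \<integral>u. norm ((real n + 1) powr p * exp (- (real n * u))) \<partial>\<nu>)"
    using summable_powr_exp_powr[OF \<epsilon>_pos \<beta>_pos] by (simp add: eq del: integral_mult_right_zero)
  show "integrable \<nu> g"
    unfolding g_def by (rule integrable_suminf[OF int AE_summable sum_int])
  show "exp 1 * (\<integral>u. g u \<partial>\<nu>) = negative_moment_bound p \<beta> \<epsilon>"
    unfolding g_def integral_suminf[OF int AE_summable sum_int] eq negative_moment_bound_def ..
qed

lemma
  assumes h: "h \<in> borel_measurable borel" and p: "0 \<le> p" and C: "0 \<le> C"
    and nonneg: "\<And>u. 0 < u \<Longrightarrow> 0 \<le> h u" and le: "\<And>u. 0 < u \<Longrightarrow> h u \<le> C * min 1 u powr (- p)"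
  shows integrable_if_le_min_1_powr: "integrable \<nu> h"
    and integral_le_if_le_min_1_powr: "(\<integral>u. h u \<partial>\<nu>) \<le> C * negative_moment_bound p \<beta> \<epsilon>"
proof -
  let ?g = "\<lambda>u. \<Sum>n. (real n + 1) powr p * exp (- (real n * u))"
  have g: "integrable \<nu> (\<lambda>u. C * exp 1 * ?g u)"
    by (intro integrable_mult_right exp_series_integral)
  have hg: "h u \<le> C * exp 1 * ?g u" if "0 < u" for u
    using le[OF that] mult_left_mono[OF min_1_powr_le_exp_series[OF that p] C]
    by (simp add: mult.assoc)
  show "integrable \<nu> h" by (rule integrable_dominated[OF h g nonneg hg])
  have "(\<integral>u. h u \<partial>\<nu>) \<le> (\<integral>u. C * exp 1 * ?g u \<partial>\<nu>)"
    by (rule integral_dominated[OF h g nonneg hg])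
  then show "(\<integral>u. h u \<partial>\<nu>) \<le> C * negative_moment_bound p \<beta> \<epsilon>"
    by (simp add: exp_series_integral(2)[symmetric] mult.assoc)
qed

lemma has_integral_window:
  assumes "0 < a" "0 < A"
  shows "has_bochner_integral \<nu> (window a A)
    ((1 - exp (- \<epsilon>)) - 2 * a * (1 - exp (- (\<epsilon> * (1 / a) powr \<beta>)))
      - 2 * (1 - exp (- (\<epsilon> * (1 / A) powr \<beta>))))"
proof -
  have "has_bochner_integral \<nu>
      (\<lambda>u. (1 - exp (- (1 * u))) - 2 * a * (1 - exp (- (1 / a * u))) - 2 * (1 - exp (- (1 / A * u))))
      ((1 - exp (- (\<epsilon> * 1 powr \<beta>))) - 2 * a * (1 - exp (- (\<epsilon> * (1 / a) powr \<beta>)))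
        - 2 * (1 - exp (- (\<epsilon> * (1 / A) powr \<beta>))))"
    using assms
    by (intro has_bochner_integral_diff has_bochner_integral_mult_right has_integral_one_minus_exp) auto
  then show ?thesis by (simp add: window_def[abs_def])
qed

lemma integral_window_ge:
  assumes "\<beta> < 1" "\<epsilon> \<le> 1"
  shows "\<epsilon> / 4 \<le> (\<integral>u. window (window_left \<beta>) (window_right \<beta>) u \<partial>\<nu>)"
proof -
  define a where "a = window_left \<beta>"
  define A where "A = window_right \<beta>"
  define X where "X = a * (1 - exp (- (\<epsilon> * (1 / a) powr \<beta>)))"
  define Y where "Y = 1 - exp (- (\<epsilon> * (1 / A) powr \<beta>))"
  have pos: "0 < a" "0 < A" by (simp_all add: a_def A_def window_left_def window_right_def)
  have "X \<le> a * (\<epsilon> * (1 / a) powr \<beta>)"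
    unfolding X_def using pos by (intro mult_left_mono one_minus_exp_le) auto
  also have "\<dots> = \<epsilon> * (window_left \<beta> * (1 / window_left \<beta>) powr \<beta>)" by (simp add: a_def)
  finally have "X \<le> \<epsilon> / 16" unfolding window_left_powr[OF assms(1)] by simp
  moreover have "Y \<le> \<epsilon> / 16"
    using one_minus_exp_le[of "\<epsilon> / 16"]
    unfolding Y_def A_def window_right_powr[OF \<beta>_pos] by simp
  moreover have "\<epsilon> / 2 \<le> 1 - exp (- \<epsilon>)"
    using min_1_le_one_minus_exp[of \<epsilon>] \<epsilon>_pos assms by simp
  ultimately have "\<epsilon> / 4 \<le> (1 - exp (- \<epsilon>)) - 2 * X - 2 * Y" by simp
  also have "\<dots> = (\<integral>u. window a A u \<partial>\<nu>)"
    using has_bochner_integral_integral_eq[OF has_integral_window[OF pos]]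
    by (simp add: X_def Y_def mult.assoc)
  finally show ?thesis unfolding a_def A_def .
qed

lemma integral_ge_window:
  assumes "\<beta> < 1" "\<epsilon> \<le> 1" and h: "integrable \<nu> h" and nonneg: "\<And>u. 0 < u \<Longrightarrow> 0 \<le> h u"
    and c: "0 \<le> c" and ge: "\<And>u. window_left \<beta> \<le> u \<Longrightarrow> u \<le> window_right \<beta> \<Longrightarrow> c \<le> h u"
  shows "c * (\<epsilon> / 4) \<le> (\<integral>u. h u \<partial>\<nu>)"
proof -
  let ?w = "window (window_left \<beta>) (window_right \<beta>)"
  have pos: "0 < window_left \<beta>" "0 < window_right \<beta>"
    by (simp_all add: window_left_def window_right_def)
  have wh: "c * ?w u \<le> h u" if "0 < u" for u
  proof -
    have "c * ?w u \<le> c * indicator {window_left \<beta>..window_right \<beta>} u"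
      using pos that c by (intro mult_left_mono window_le_indicator)
    also have "\<dots> \<le> h u" using ge nonneg[OF that] by (simp add: indicator_def)
    finally show ?thesis .
  qed
  have w: "integrable \<nu> ?w"
    using has_integral_window[OF pos] by (auto simp: has_bochner_integral_iff)
  have "c * (\<epsilon> / 4) \<le> c * (\<integral>u. ?w u \<partial>\<nu>)"
    using integral_window_ge[OF assms(1,2)] c by (rule mult_left_mono)
  also have "\<dots> = (\<integral>u. c * ?w u \<partial>\<nu>)" by simp
  also have "\<dots> \<le> (\<integral>u. h u \<partial>\<nu>)"
    using AE_pos w h by (intro integral_mono_AE) (auto elim!: eventually_mono intro: wh)
  finally show ?thesis .
qed

end

definition subordinator_law :: "(real \<Rightarrow> real \<Rightarrow> real) \<Rightarrow> real \<Rightarrow> real \<Rightarrow> real measure" where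
  "subordinator_law \<sigma> t c =
     distr (density lebesgue (\<lambda>\<tau>. ennreal (indicator {0<..} \<tau> * \<sigma> t \<tau>))) borel (\<lambda>\<tau>. \<tau> / c)"

lemma stable_subordinator_density_laplace:
  assumes "stable_subordinator_density \<alpha> \<sigma>" "0 < t" "0 \<le> l"
  shows "has_bochner_integral lebesgue (\<lambda>\<tau>. indicator {0<..} \<tau> * \<sigma> t \<tau> * exp (- (l * \<tau>)))
    (exp (- (t * l powr (\<alpha> / 2))))"
proof -
  have nonneg: "0 \<le> \<sigma> t \<tau>" if "0 < \<tau>" for \<tau>
    using assms that by (simp add: stable_subordinator_density_def)
  have lap: "((\<lambda>\<tau>. exp (- \<tau> * l) * \<sigma> t \<tau>) has_integral exp (- t * l powr (\<alpha> / 2))) {0<..}"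
    using assms by (simp add: stable_subordinator_density_def)
  have int: "set_integrable lebesgue {0<..} (\<lambda>\<tau>. exp (- \<tau> * l) * \<sigma> t \<tau>)"
    using lap nonneg
    by (intro nonnegative_absolutely_integrable_1) (auto simp: integrable_on_def)
  have "(LINT \<tau>:{0<..}|lebesgue. exp (- \<tau> * l) * \<sigma> t \<tau>) = exp (- t * l powr (\<alpha> / 2))"
    using set_lebesgue_integral_eq_integral(2)[OF int] integral_unique[OF lap] by simp
  then show ?thesis
    using int
    by (simp add: has_bochner_integral_iff set_integrable_def set_lebesgue_integral_def mult_ac)
qed

lemma stable_subordinator_density_measurable:
  assumes "stable_subordinator_density \<alpha> \<sigma>" "0 < t"
  shows "(\<lambda>\<tau>. indicator {0<..} \<tau> * \<sigma> t \<tau>) \<in> borel_measurable lebesgue"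
  using stable_subordinator_density_laplace[OF assms, of 0]
  by (auto simp: has_bochner_integral_iff dest: borel_measurable_integrable)

lemma stable_law_subordinator_law:
  assumes \<sigma>: "stable_subordinator_density \<alpha> \<sigma>" and "0 < \<alpha>" "0 < t" "0 < c"
  shows "stable_law (subordinator_law \<sigma> t c) (\<alpha> / 2) (t / c powr (\<alpha> / 2))"
proof
  let ?f = "\<lambda>\<tau>. indicator {0<..} \<tau> * \<sigma> t \<tau>"
  have f [measurable]: "?f \<in> borel_measurable lebesgue"
    using \<sigma> \<open>0 < t\<close> by (rule stable_subordinator_density_measurable)
  have f_nonneg: "0 \<le> ?f \<tau>" for \<tau>
    using \<sigma> \<open>0 < t\<close> by (auto simp: stable_subordinator_density_def indicator_def)
  have scale [measurable]: "(\<lambda>\<tau>. \<tau> / c) \<in> borel_measurable lebesgue"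
    by (intro measurable_completion) simp
  show "sets (subordinator_law \<sigma> t c) = sets borel" by (simp add: subordinator_law_def)
  have "AE \<tau> in density lebesgue (\<lambda>\<tau>. ennreal (?f \<tau>)). 0 < \<tau> / c"
    using \<open>0 < c\<close> by (subst AE_density) (measurable, auto simp: indicator_def)
  then show "AE u in subordinator_law \<sigma> t c. 0 < u"
    unfolding subordinator_law_def by (subst AE_distr_iff) auto
  show "has_bochner_integral (subordinator_law \<sigma> t c) (\<lambda>u. exp (- (l * u)))
      (exp (- (t / c powr (\<alpha> / 2) * l powr (\<alpha> / 2))))" if "0 \<le> l" for l
    unfolding subordinator_law_def
  proof (intro has_bochner_integral_distr has_bochner_integral_density)
    show "has_bochner_integral lebesgue (\<lambda>\<tau>. ?f \<tau> *\<^sub>R exp (- (l * (\<tau> / c))))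
        (exp (- (t / c powr (\<alpha> / 2) * l powr (\<alpha> / 2))))"
      using stable_subordinator_density_laplace[OF \<sigma> \<open>0 < t\<close>, of "l / c"] assms that
      by (simp add: powr_divide mult_ac)
    show "(\<lambda>\<tau>. exp (- (l * (\<tau> / c)))) \<in> borel_measurable lebesgue" by measurable
  qed (use f_nonneg in auto)
qed (use assms in auto)

lemma integral_subordinator_law:
  fixes h :: "real \<Rightarrow> real"
  assumes \<sigma>: "stable_subordinator_density \<alpha> \<sigma>" and "0 < t" "0 < c"
    and h [measurable]: "h \<in> borel_measurable borel"
    and int: "integrable (subordinator_law \<sigma> t c) (\<lambda>u. h (c * u))"
  shows "integral {0<..} (\<lambda>\<tau>. h \<tau> * \<sigma> t \<tau>) = (\<integral>u. h (c * u) \<partial>subordinator_law \<sigma> t c)"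
proof -
  let ?f = "\<lambda>\<tau>. indicator {0<..} \<tau> * \<sigma> t \<tau>"
  have f [measurable]: "?f \<in> borel_measurable lebesgue"
    using \<sigma> \<open>0 < t\<close> by (rule stable_subordinator_density_measurable)
  have f_nonneg: "AE \<tau> in lebesgue. 0 \<le> ?f \<tau>"
    using \<sigma> \<open>0 < t\<close> by (auto simp: stable_subordinator_density_def indicator_def)
  have h' [measurable]: "h \<in> borel_measurable lebesgue"
    using h by (intro measurable_completion) simp
  have scale [measurable]: "(\<lambda>\<tau>. \<tau> / c) \<in> borel_measurable lebesgue"
    by (intro measurable_completion) simp
  have "integrable lebesgue (\<lambda>\<tau>. ?f \<tau> * h \<tau>)"
    using int \<open>0 < c\<close> f_nonneg
    by (simp add: subordinator_law_def integrable_distr_eq integrable_density)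
  then have set: "set_integrable lebesgue {0<..} (\<lambda>\<tau>. h \<tau> * \<sigma> t \<tau>)"
    by (simp add: set_integrable_def mult_ac)
  have "(\<integral>u. h (c * u) \<partial>subordinator_law \<sigma> t c) = (\<integral>\<tau>. ?f \<tau> * h \<tau> \<partial>lebesgue)"
    using \<open>0 < c\<close> f_nonneg
    by (simp add: subordinator_law_def integral_distr integral_density)
  also have "\<dots> = integral {0<..} (\<lambda>\<tau>. h \<tau> * \<sigma> t \<tau>)"
    unfolding set_lebesgue_integral_eq_integral(2)[OF set, symmetric] set_lebesgue_integral_def
    by (simp add: mult_ac)
  finally show ?thesis by simp
qed

section \<open>The subordinated kernel\<close>

lemma powr_le_exp:
  fixes y q \<epsilon> :: real
  assumes "0 \<le> y" "0 < q" "0 < \<epsilon>"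
  shows "y powr q \<le> (q / \<epsilon>) powr q * exp (\<epsilon> * y)"
proof -
  have "y = q / \<epsilon> * (\<epsilon> * y / q)" using assms by simp
  then have "y powr q = (q / \<epsilon>) powr q * (\<epsilon> * y / q) powr q"
    by (metis powr_mult)
  also have "\<dots> \<le> (q / \<epsilon>) powr q * exp (\<epsilon> * y / q) powr q"
  proof (intro mult_left_mono powr_mono2)
    show "\<epsilon> * y / q \<le> exp (\<epsilon> * y / q)" using exp_ge_add_one_self[of "\<epsilon> * y / q"] by linarith
  qed (use assms in auto)
  also have "exp (\<epsilon> * y / q) powr q = exp (\<epsilon> * y)" using assms by (simp add: powr_def)
  finally show ?thesis .
qed

lemma min_1_powr_gaussian_le:
  fixes u p :: real
  assumes "0 < u" "0 \<le> p"
  shows "min 1 u powr (- p) * exp (- (1 / (4 * u))) \<le> (4 * (p + 1)) powr (p + 1) * min 1 u"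
proof (cases "u \<le> 1")
  case True
  have "u powr (- p) = u * (1 / u) powr (p + 1)"
    using assms by (simp add: powr_divide powr_add powr_minus_divide)
  also have "(1 / u) powr (p + 1) \<le> ((p + 1) / (1/4)) powr (p + 1) * exp (1/4 * (1 / u))"
    using assms by (intro powr_le_exp) auto
  finally have "u powr (- p) * exp (- (1 / (4 * u)))
      \<le> u * ((4 * (p + 1)) powr (p + 1) * exp (1 / (4 * u))) * exp (- (1 / (4 * u)))"
    using assms by (simp add: mult.commute)
  also have "\<dots> = (4 * (p + 1)) powr (p + 1) * u" by (simp add: exp_minus)
  finally show ?thesis using True by (simp add: min_def)
next
  case False
  have "exp (- (1 / (4 * u))) \<le> 1" using assms by simp
  also have "1 \<le> (4 * (p + 1)) powr (p + 1)"
    using assms by (intro ge_one_powr_ge_zero) auto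
  finally show ?thesis using False by (simp add: min_def)
qed

lemma affine_within_factor:
  fixes x y u :: real
  assumes "0 \<le> x" "0 < y" "0 < u"
  shows "within_factor (max u (1 / u)) (x + y * u) (x + y)"
proof -
  define k where "k = max u (1 / u)"
  have "1 \<le> k" using assms by (cases "1 \<le> u") (auto simp: k_def le_max_iff_disj)
  then have x: "x \<le> k * x" using assms by (simp add: mult_le_cancel_right1)
  have "y * u \<le> k * y" using assms by (simp add: k_def mult.commute)
  with x have "x + y * u \<le> k * (x + y)" unfolding distrib_left by linarith
  moreover have "1 / u \<le> k" by (simp add: k_def)
  then have "y \<le> k * (y * u)" using assms by (simp add: field_simps)
  with x have "x + y \<le> k * (x + y * u)" unfolding distrib_left by linarith
  ultimately show ?thesis
    using assms by (simp add: within_factor_def k_def[symmetric] add_nonneg_pos)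
qed

lemma powr_affine_le_if_le_1:
  fixes x y u \<zeta> :: real
  assumes "0 \<le> x" "0 < y" "0 < u" "u \<le> 1"
  shows "u powr (-1/2) * (x + y * u) powr (- \<zeta>) \<le> u powr (- (1/2 + \<bar>\<zeta>\<bar>)) * (x + y) powr (- \<zeta>)"
proof -
  have "u \<le> 1 / u" using assms order.trans[of u 1 "1 / u"] by simp
  then have "max u (1 / u) = 1 / u" by simp
  then have "(x + y * u) powr (- \<zeta>) \<le> (1 / u) powr \<bar>- \<zeta>\<bar> * (x + y) powr (- \<zeta>)"
    using within_factor_powr[OF affine_within_factor[OF assms(1-3)], of "- \<zeta>"]
    by (simp add: within_factor_def)
  then have "u powr (-1/2) * (x + y * u) powr (- \<zeta>)
      \<le> u powr (-1/2) * ((1 / u) powr \<bar>\<zeta>\<bar> * (x + y) powr (- \<zeta>))"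
    by (intro mult_left_mono) auto
  also have "\<dots> = u powr (-1/2) * u powr (- \<bar>\<zeta>\<bar>) * (x + y) powr (- \<zeta>)"
    by (simp add: powr_divide powr_minus_divide)
  also have "u powr (-1/2) * u powr (- \<bar>\<zeta>\<bar>) = u powr (- (1/2 + \<bar>\<zeta>\<bar>))"
    by (simp add: powr_add[symmetric])
  finally show ?thesis .
qed

lemma powr_affine_le_if_ge_1:
  fixes x y u \<zeta> :: real
  assumes "-1/2 < \<zeta>" "0 \<le> x" "0 < y" "1 \<le> u"
  shows "u powr (-1/2) * (x + y * u) powr (- \<zeta>) \<le> (x + y) powr (- \<zeta>)"
proof (cases "0 \<le> \<zeta>")
  case True
  have "u powr (-1/2) \<le> 1" using assms powr_mono[of "-1/2" 0 u] by simp
  moreover have "(x + y * u) powr (- \<zeta>) \<le> (x + y) powr (- \<zeta>)"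
    using True assms by (intro powr_mono2') auto
  ultimately have "u powr (-1/2) * (x + y * u) powr (- \<zeta>) \<le> 1 * (x + y) powr (- \<zeta>)"
    by (intro mult_mono) auto
  then show ?thesis by simp
next
  case False
  have "x * 1 \<le> x * u" using assms by (intro mult_left_mono) auto
  then have "(x + y * u) powr (- \<zeta>) \<le> (u * (x + y)) powr (- \<zeta>)"
    using False assms by (intro powr_mono2) (auto simp: algebra_simps)
  also have "\<dots> = u powr (- \<zeta>) * (x + y) powr (- \<zeta>)" by (rule powr_mult)
  finally have "u powr (-1/2) * (x + y * u) powr (- \<zeta>)
      \<le> u powr (-1/2) * (u powr (- \<zeta>) * (x + y) powr (- \<zeta>))"
    by (intro mult_left_mono) auto
  also have "\<dots> = u powr (-1/2 - \<zeta>) * (x + y) powr (- \<zeta>)"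
    using powr_add[of u "-1/2" "- \<zeta>"] by simp
  also have "\<dots> \<le> 1 * (x + y) powr (- \<zeta>)"
    using assms powr_mono[of "-1/2 - \<zeta>" 0 u] by (intro mult_right_mono) auto
  finally show ?thesis by simp
qed

lemma heat_profile_scaled:
  assumes "0 < D"
  shows "heat_profile \<zeta> (D\<^sup>2 * u) r s = 1 / D * (u powr (-1/2) * (r * s + D\<^sup>2 * u) powr (- \<zeta>))
    * exp (- ((r - s)\<^sup>2 / D\<^sup>2 / (4 * u)))"
proof -
  have "(D\<^sup>2) powr (-1/2) = 1 / D"
    using assms powr_powr[of D 2 "-1/2"] by (simp add: powr_minus_divide)
  then have "(D\<^sup>2 * u) powr (-1/2) = 1 / D * u powr (-1/2)" by (simp only: powr_mult)
  then show ?thesis by (simp add: heat_profile_def powr_minus_divide mult_ac)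
qed

lemma heat_profile_upper:
  assumes "-1/2 < \<zeta>" "0 < r" "0 < s" "0 < D" "0 < u"
  shows "heat_profile \<zeta> (D\<^sup>2 * u) r s \<le> heat_amplitude \<zeta> D r s
    * (min 1 u powr (- (1/2 + \<bar>\<zeta>\<bar>)) * exp (- ((r - s)\<^sup>2 / D\<^sup>2 / (4 * u))))"
proof -
  have "u powr (-1/2) * (r * s + D\<^sup>2 * u) powr (- \<zeta>)
      \<le> min 1 u powr (- (1/2 + \<bar>\<zeta>\<bar>)) * (r * s + D\<^sup>2) powr (- \<zeta>)"
    using assms powr_affine_le_if_le_1[of "r * s" "D\<^sup>2" u \<zeta>]
      powr_affine_le_if_ge_1[of \<zeta> "r * s" "D\<^sup>2" u]
    by (cases "u \<le> 1") (simp_all add: min_def)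
  then have "heat_profile \<zeta> (D\<^sup>2 * u) r s \<le> 1 / D
      * (min 1 u powr (- (1/2 + \<bar>\<zeta>\<bar>)) * (r * s + D\<^sup>2) powr (- \<zeta>))
      * exp (- ((r - s)\<^sup>2 / D\<^sup>2 / (4 * u)))"
    unfolding heat_profile_scaled[OF assms(4)] using assms
    by (intro mult_right_mono mult_left_mono) auto
  then show ?thesis by (simp add: heat_amplitude_def mult_ac)
qed

lemma heat_profile_lower:
  fixes a A :: real
  assumes "0 < r" "0 < s" "0 < D" "\<bar>r - s\<bar> \<le> D" "0 < a" "a \<le> u" "u \<le> A"
  shows "heat_amplitude \<zeta> D r s
      * (A powr (-1/2) * max A (1 / a) powr (- \<bar>\<zeta>\<bar>) * exp (- (1 / (4 * a))))
    \<le> heat_profile \<zeta> (D\<^sup>2 * u) r s"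
proof -
  define k where "k = max A (1 / a)"
  have u: "0 < u" using assms by simp
  have "1 / u \<le> 1 / a" using assms u by (simp add: frac_le)
  then have "max u (1 / u) \<le> k" using assms by (auto simp: k_def)
  with affine_within_factor[of "r * s" "D\<^sup>2" u]
  have near: "within_factor k (r * s + D\<^sup>2 * u) (r * s + D\<^sup>2)"
    using assms u by (auto intro: within_factor_mono)
  then have k: "0 < k" using within_factor_ge_1 by fastforce
  have "(r * s + D\<^sup>2) powr (- \<zeta>) \<le> k powr \<bar>- \<zeta>\<bar> * (r * s + D\<^sup>2 * u) powr (- \<zeta>)"
    using within_factor_powr[OF near, of "- \<zeta>"] by (simp add: within_factor_def)
  then have base: "k powr (- \<bar>\<zeta>\<bar>) * (r * s + D\<^sup>2) powr (- \<zeta>) \<le> (r * s + D\<^sup>2 * u) powr (- \<zeta>)"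
    using k by (simp add: powr_minus_divide[of k] pos_divide_le_eq mult.commute)
  have "(r - s)\<^sup>2 \<le> D\<^sup>2" using assms by (simp add: abs_le_square_iff[symmetric])
  then have "(r - s)\<^sup>2 / D\<^sup>2 / (4 * u) \<le> 1 / (4 * a)"
    using assms u by (intro frac_le) auto
  then have gauss: "exp (- (1 / (4 * a))) \<le> exp (- ((r - s)\<^sup>2 / D\<^sup>2 / (4 * u)))" by simp
  have "A powr (-1/2) \<le> u powr (-1/2)" using assms u by (intro powr_mono2') auto
  then have "1 / D * (A powr (-1/2) * (k powr (- \<bar>\<zeta>\<bar>) * (r * s + D\<^sup>2) powr (- \<zeta>)))
      * exp (- (1 / (4 * a))) \<le> heat_profile \<zeta> (D\<^sup>2 * u) r s"
    unfolding heat_profile_scaled[OF assms(3)] using assms base gauss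
    by (intro mult_mono mult_left_mono) auto
  then show ?thesis by (simp add: heat_amplitude_def k_def mult_ac)
qed

lemma bessel_heat_measurable [measurable]:
  "(\<lambda>\<tau>. bessel_heat \<zeta> \<tau> r s) \<in> borel_measurable borel"
  unfolding bessel_heat_def bessel_I_def by measurable

lemma jump_scale_exponent:
  assumes "0 < \<alpha>" "0 < t"
  shows "t / jump_scale \<alpha> t r s powr \<alpha> \<le> 1"
    and "jump_scale \<alpha> t r s \<noteq> \<bar>r - s\<bar> \<Longrightarrow> t / jump_scale \<alpha> t r s powr \<alpha> = 1"
proof -
  have t: "(t powr (1 / \<alpha>)) powr \<alpha> = t" using assms by (simp add: powr_powr)
  have "t \<le> jump_scale \<alpha> t r s powr \<alpha>"
    using assms powr_mono2[of \<alpha> "t powr (1 / \<alpha>)" "jump_scale \<alpha> t r s"]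
    by (simp add: t jump_scale_def)
  then show "t / jump_scale \<alpha> t r s powr \<alpha> \<le> 1"
    using assms by (simp add: divide_le_eq_1)
  assume "jump_scale \<alpha> t r s \<noteq> \<bar>r - s\<bar>"
  then have "jump_scale \<alpha> t r s = t powr (1 / \<alpha>)"
    by (simp add: jump_scale_def max_def split: if_splits)
  then show "t / jump_scale \<alpha> t r s powr \<alpha> = 1" using assms t by simp
qed

definition near_factor :: "real \<Rightarrow> real \<Rightarrow> real" where
  "near_factor \<zeta> \<alpha> = negative_moment_bound (1/2 + \<bar>\<zeta>\<bar>) (\<alpha> / 2) 1"

definition far_factor :: "real \<Rightarrow> real" where
  "far_factor \<zeta> = 2 * (4 * (1/2 + \<bar>\<zeta>\<bar> + 1)) powr (1/2 + \<bar>\<zeta>\<bar> + 1)"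

definition lower_factor :: "real \<Rightarrow> real \<Rightarrow> real" where
  "lower_factor \<zeta> \<alpha> =
     (let a = window_left (\<alpha> / 2); A = window_right (\<alpha> / 2)
      in A powr (-1/2) * max A (1 / a) powr (- \<bar>\<zeta>\<bar>) * exp (- (1 / (4 * a))) / 4)"

lemma lower_factor_pos: "0 < lower_factor \<zeta> \<alpha>"
proof -
  have "0 < window_right (\<alpha> / 2)" by (simp add: window_right_def)
  then have "0 < max (window_right (\<alpha> / 2)) (1 / window_left (\<alpha> / 2))"
    by (simp add: less_max_iff_disj)
  with \<open>0 < window_right (\<alpha> / 2)\<close> show ?thesis by (simp add: lower_factor_def Let_def)
qed

locale subordinated_bessel =
  fixes \<zeta> \<alpha> r s t K :: real and \<sigma> :: "real \<Rightarrow> real \<Rightarrow> real"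
  assumes \<zeta>: "-1/2 < \<zeta>" and \<alpha>: "0 < \<alpha>" "\<alpha> < 2" and pos: "0 < r" "0 < s" "0 < t"
    and density: "stable_subordinator_density \<alpha> \<sigma>"
    and bessel_heat: "0 < \<tau> \<Longrightarrow> within_factor K (bessel_heat \<zeta> \<tau> r s) (heat_profile \<zeta> \<tau> r s)"
begin

abbreviation D :: real where
  "D \<equiv> jump_scale \<alpha> t r s"

definition scaled_law :: "real measure" where
  "scaled_law = subordinator_law \<sigma> t (D\<^sup>2)"

definition scaled_heat :: "real \<Rightarrow> real" where
  "scaled_heat u = bessel_heat \<zeta> (D\<^sup>2 * u) r s"

lemma D_pos: "0 < D"
  using pos(3) by (rule jump_scale_pos)

sublocale stable_law scaled_law "\<alpha> / 2" "t / D powr \<alpha>"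
proof -
  have "(D\<^sup>2) powr (\<alpha> / 2) = D powr \<alpha>" using D_pos powr_powr[of D 2 "\<alpha> / 2"] by simp
  then show "stable_law scaled_law (\<alpha> / 2) (t / D powr \<alpha>)"
    using stable_law_subordinator_law[OF density \<alpha>(1) pos(3), of "D\<^sup>2"] D_pos
    by (simp add: scaled_law_def)
qed

lemma scaled_heat_measurable: "scaled_heat \<in> borel_measurable borel"
  unfolding scaled_heat_def[abs_def] by measurable

lemma scaled_heat_within_factor:
  "0 < u \<Longrightarrow> within_factor K (scaled_heat u) (heat_profile \<zeta> (D\<^sup>2 * u) r s)"
  unfolding scaled_heat_def using D_pos by (intro bessel_heat) auto

lemma scaled_heat_nonneg: "0 < u \<Longrightarrow> 0 \<le> scaled_heat u"
  using scaled_heat_within_factor[of u] by (simp add: within_factor_def)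

lemma K_ge_1: "1 \<le> K"
  using within_factor_ge_1[OF scaled_heat_within_factor[of 1]] by simp

lemma heat_amplitude_pos: "0 < heat_amplitude \<zeta> D r s"
  using D_pos pos by (simp add: heat_amplitude_def add_pos_nonneg less_imp_neq[symmetric])

lemma jump_profile_pos: "0 < jump_profile \<zeta> \<alpha> t r s"
  using heat_amplitude_pos D_pos pos by (simp add: jump_profile_def)

lemma scaled_heat_le:
  assumes "0 < u"
  shows "scaled_heat u \<le> K * heat_amplitude \<zeta> D r s
    * (min 1 u powr (- (1/2 + \<bar>\<zeta>\<bar>)) * exp (- ((r - s)\<^sup>2 / D\<^sup>2 / (4 * u))))"
proof -
  have "scaled_heat u \<le> K * heat_profile \<zeta> (D\<^sup>2 * u) r s"
    using scaled_heat_within_factor[OF assms] by (simp add: within_factor_def)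
  also have "\<dots> \<le> K * (heat_amplitude \<zeta> D r s
      * (min 1 u powr (- (1/2 + \<bar>\<zeta>\<bar>)) * exp (- ((r - s)\<^sup>2 / D\<^sup>2 / (4 * u)))))"
    using K_ge_1 \<zeta> pos D_pos assms by (intro mult_left_mono heat_profile_upper) auto
  finally show ?thesis by (simp only: mult.assoc)
qed

lemma
  assumes "D = \<bar>r - s\<bar>"
  shows integrable_scaled_heat_far: "integrable scaled_law scaled_heat"
    and integral_scaled_heat_far:
      "(\<integral>u. scaled_heat u \<partial>scaled_law) \<le> far_factor \<zeta> * (K * jump_profile \<zeta> \<alpha> t r s)"
proof -
  define p where "p = 1/2 + \<bar>\<zeta>\<bar>"
  define C where "C = K * heat_amplitude \<zeta> D r s"
  define M where "M = (4 * (p + 1)) powr (p + 1)"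
  have p: "0 \<le> p" and C: "0 \<le> C" and M: "0 \<le> M"
    using K_ge_1 heat_amplitude_pos by (simp_all add: p_def C_def M_def)
  have le: "scaled_heat u \<le> C * M * min 1 u" if "0 < u" for u
  proof -
    have ratio: "(r - s)\<^sup>2 / D\<^sup>2 = 1" using assms D_pos by simp
    have "scaled_heat u \<le> C * (min 1 u powr (- p) * exp (- (1 / (4 * u))))"
      using scaled_heat_le[OF that] unfolding ratio C_def p_def .
    also have "\<dots> \<le> C * (M * min 1 u)"
      unfolding M_def using C p that by (intro mult_left_mono min_1_powr_gaussian_le)
    finally show ?thesis by (simp only: mult.assoc)
  qed
  note bound = scaled_heat_measurable scaled_heat_nonneg le mult_nonneg_nonneg[OF C M]
  show "integrable scaled_law scaled_heat" by (rule integrable_if_le_min_1[OF bound])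
  have "(\<integral>u. scaled_heat u \<partial>scaled_law) \<le> 2 * (C * M) * (t / D powr \<alpha>)"
    by (rule integral_le_if_le_min_1[OF bound])
  also have "\<dots> = far_factor \<zeta> * (K * jump_profile \<zeta> \<alpha> t r s)"
    by (simp add: far_factor_def jump_profile_def C_def M_def p_def)
  finally show "(\<integral>u. scaled_heat u \<partial>scaled_law) \<le> far_factor \<zeta> * (K * jump_profile \<zeta> \<alpha> t r s)" .
qed

lemma
  assumes "D \<noteq> \<bar>r - s\<bar>"
  shows integrable_scaled_heat_near: "integrable scaled_law scaled_heat"
    and integral_scaled_heat_near:
      "(\<integral>u. scaled_heat u \<partial>scaled_law) \<le> near_factor \<zeta> \<alpha> * (K * jump_profile \<zeta> \<alpha> t r s)"
proof -
  define p where "p = 1/2 + \<bar>\<zeta>\<bar>"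
  define C where "C = K * heat_amplitude \<zeta> D r s"
  have p: "0 \<le> p" and C: "0 \<le> C"
    using K_ge_1 heat_amplitude_pos by (simp_all add: p_def C_def)
  have le: "scaled_heat u \<le> C * min 1 u powr (- p)" if "0 < u" for u
  proof -
    have "min 1 u powr (- p) * exp (- ((r - s)\<^sup>2 / D\<^sup>2 / (4 * u))) \<le> min 1 u powr (- p)"
      using that by (intro mult_left_le) auto
    from mult_left_mono[OF this C] show ?thesis
      using scaled_heat_le[OF that] by (simp add: C_def p_def)
  qed
  note bound = scaled_heat_measurable p C scaled_heat_nonneg le
  show "integrable scaled_law scaled_heat" by (rule integrable_if_le_min_1_powr[OF bound])
  have \<epsilon>: "t / D powr \<alpha> = 1" using \<alpha>(1) pos(3) assms by (rule jump_scale_exponent)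
  show "(\<integral>u. scaled_heat u \<partial>scaled_law) \<le> near_factor \<zeta> \<alpha> * (K * jump_profile \<zeta> \<alpha> t r s)"
    using integral_le_if_le_min_1_powr[OF bound]
    unfolding \<epsilon> near_factor_def jump_profile_def C_def p_def by (simp add: mult_ac)
qed

lemma integrable_scaled_heat: "integrable scaled_law scaled_heat"
  using integrable_scaled_heat_far integrable_scaled_heat_near by blast

lemma integral_scaled_heat_le:
  "(\<integral>u. scaled_heat u \<partial>scaled_law)
    \<le> max (far_factor \<zeta>) (near_factor \<zeta> \<alpha>) * (K * jump_profile \<zeta> \<alpha> t r s)"
proof -
  have "0 \<le> K * jump_profile \<zeta> \<alpha> t r s" using K_ge_1 jump_profile_pos by simp
  then show ?thesis
    using integral_scaled_heat_far integral_scaled_heat_near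
    by (cases "D = \<bar>r - s\<bar>") (fastforce intro: order.trans mult_right_mono)+
qed

lemma integral_scaled_heat_ge:
  "lower_factor \<zeta> \<alpha> / K * jump_profile \<zeta> \<alpha> t r s \<le> (\<integral>u. scaled_heat u \<partial>scaled_law)"
proof -
  define c where "c = 4 * lower_factor \<zeta> \<alpha> / K * heat_amplitude \<zeta> D r s"
  have "c \<le> scaled_heat u" if u: "window_left (\<alpha> / 2) \<le> u" "u \<le> window_right (\<alpha> / 2)" for u
  proof -
    have left: "0 < window_left (\<alpha> / 2)" by (simp add: window_left_def)
    have "K * c = heat_amplitude \<zeta> D r s * (4 * lower_factor \<zeta> \<alpha>)"
      using K_ge_1 by (simp add: c_def)
    also have "\<dots> \<le> heat_profile \<zeta> (D\<^sup>2 * u) r s"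
      using heat_profile_lower[OF pos(1,2) D_pos _ left u, of \<zeta>]
      by (simp add: lower_factor_def Let_def jump_scale_def)
    also have "\<dots> \<le> K * scaled_heat u"
      using scaled_heat_within_factor[of u] left u by (simp add: within_factor_def)
    finally show ?thesis using K_ge_1 by simp
  qed
  moreover have "0 \<le> c"
    using lower_factor_pos[of \<zeta> \<alpha>] K_ge_1 heat_amplitude_pos by (simp add: c_def)
  ultimately have "c * (t / D powr \<alpha> / 4) \<le> (\<integral>u. scaled_heat u \<partial>scaled_law)"
    using \<alpha> pos(3) jump_scale_exponent(1) scaled_heat_nonneg integrable_scaled_heat
    by (intro integral_ge_window) auto
  then show ?thesis by (simp add: c_def jump_profile_def mult_ac)
qed

lemma sub_bessel_heat_eq: "sub_bessel_heat \<sigma> \<zeta> t r s = (\<integral>u. scaled_heat u \<partial>scaled_law)"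
  unfolding sub_bessel_heat_def scaled_heat_def scaled_law_def
  using integrable_scaled_heat D_pos
  by (intro integral_subordinator_law[OF density pos(3)])
     (auto simp: scaled_heat_def[abs_def] scaled_law_def)

lemma sub_bessel_heat_within_factor:
  "within_factor (K * max (max (far_factor \<zeta>) (near_factor \<zeta> \<alpha>)) (1 / lower_factor \<zeta> \<alpha>))
    (sub_bessel_heat \<sigma> \<zeta> t r s) (jump_profile \<zeta> \<alpha> t r s)"
proof -
  define U where "U = max (far_factor \<zeta>) (near_factor \<zeta> \<alpha>)"
  define L where "L = lower_factor \<zeta> \<alpha>"
  let ?S = "sub_bessel_heat \<sigma> \<zeta> t r s" and ?J = "jump_profile \<zeta> \<alpha> t r s"
  have L: "0 < L" unfolding L_def by (rule lower_factor_pos)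
  have upper: "?S \<le> K * U * ?J"
    using integral_scaled_heat_le by (simp add: U_def sub_bessel_heat_eq mult_ac)
  have lower: "L / K * ?J \<le> ?S"
    using integral_scaled_heat_ge by (simp add: L_def sub_bessel_heat_eq)
  moreover have "0 < L / K * ?J" using L K_ge_1 jump_profile_pos by simp
  ultimately have "0 < ?S" by linarith
  moreover have "?J \<le> K * (1 / L) * ?S"
    using lower L K_ge_1 by (simp add: field_simps)
  ultimately have "within_factor (max (K * U) (K * (1 / L))) ?S ?J"
    using upper jump_profile_pos by (intro within_factor_maxI)
  then show ?thesis using K_ge_1 by (simp only: U_def L_def max_mult_distrib_left) simp
qed

end

lemma bessel_heat_bounds:
  assumes "-1/2 < \<zeta>"
  obtains K where "0 < K"
    "\<And>r s t. 0 < r \<Longrightarrow> 0 < s \<Longrightarrow> 0 < t \<Longrightarrow> 1 / K * heat_profile \<zeta> t r s \<le> bessel_heat \<zeta> t r s"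
    "\<And>r s t. 0 < r \<Longrightarrow> 0 < s \<Longrightarrow> 0 < t \<Longrightarrow> bessel_heat \<zeta> t r s \<le> K * heat_profile \<zeta> t r s"
    "\<And>r s t. 0 < r \<Longrightarrow> 0 < s \<Longrightarrow> 0 < t \<Longrightarrow>
      1 / K * (A_zeta \<zeta> t r s * exp (- (r - s)\<^sup>2 / (8/3 * t))) \<le> bessel_heat \<zeta> t r s"
    "\<And>r s t. 0 < r \<Longrightarrow> 0 < s \<Longrightarrow> 0 < t \<Longrightarrow>
      bessel_heat \<zeta> t r s \<le> K * (A_zeta \<zeta> t r s * exp (- (r - s)\<^sup>2 / (8 * t)))"
proof -
  obtain L where L: "\<And>r s t. 0 < r \<Longrightarrow> 0 < s \<Longrightarrow> 0 < t \<Longrightarrow>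
      within_factor L (bessel_heat \<zeta> t r s) (heat_profile \<zeta> t r s)"
    using bessel_heat_within_factor[OF assms] by blast
  define C where "C = 2 powr \<bar>\<zeta>\<bar> * exp (2 * \<zeta>\<^sup>2)"
  have L_ge_1: "1 \<le> L" using within_factor_ge_1[OF L[of 1 1 1]] by simp
  have "1 * 1 \<le> C"
    unfolding C_def by (intro mult_mono) (auto simp: ge_one_powr_ge_zero)
  then have C: "0 < C" and L_le: "L \<le> C * L" using L_ge_1 by auto
  show ?thesis
  proof (rule that[of "C * L"])
    show "0 < C * L" using C L_ge_1 by simp
    fix r s t :: real
    assume rst: "0 < r" "0 < s" "0 < t"
    note A_zeta = heat_profile_A_zeta_bounds[OF rst, of \<zeta>, folded C_def]
    have lower: "heat_profile \<zeta> t r s \<le> L * bessel_heat \<zeta> t r s"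
      and upper: "bessel_heat \<zeta> t r s \<le> L * heat_profile \<zeta> t r s"
      using L[OF rst] by (auto simp: within_factor_def)
    have "within_factor (C * L) (bessel_heat \<zeta> t r s) (heat_profile \<zeta> t r s)"
      using L[OF rst] L_le by (rule within_factor_mono)
    then show "1 / (C * L) * heat_profile \<zeta> t r s \<le> bessel_heat \<zeta> t r s"
      and "bessel_heat \<zeta> t r s \<le> C * L * heat_profile \<zeta> t r s"
      using C L_ge_1 by (auto simp: within_factor_def pos_divide_le_eq mult.commute)
    have "A_zeta \<zeta> t r s * exp (- (r - s)\<^sup>2 / (8/3 * t)) \<le> C * (L * bessel_heat \<zeta> t r s)"
      using A_zeta(1) mult_left_mono[OF lower, of C] C by linarith
    then show "1 / (C * L) * (A_zeta \<zeta> t r s * exp (- (r - s)\<^sup>2 / (8/3 * t))) \<le> bessel_heat \<zeta> t r s"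
      using C L_ge_1 by (simp add: pos_divide_le_eq mult_ac)
    have "bessel_heat \<zeta> t r s \<le> L * (C * (A_zeta \<zeta> t r s * exp (- (r - s)\<^sup>2 / (8 * t))))"
      using upper mult_left_mono[OF A_zeta(2), of L] L_ge_1 by linarith
    then show "bessel_heat \<zeta> t r s \<le> C * L * (A_zeta \<zeta> t r s * exp (- (r - s)\<^sup>2 / (8 * t)))"
      by (simp only: mult_ac)
  qed
qed

lemma sub_bessel_heat_Q_bound:
  assumes "-1/2 < \<zeta>" "0 < \<alpha>" "\<alpha> < 2"
  obtains K where "1 \<le> K"
    "\<And>\<sigma> r s t. stable_subordinator_density \<alpha> \<sigma> \<Longrightarrow> 0 < r \<Longrightarrow> 0 < s \<Longrightarrow> 0 < t \<Longrightarrow>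
      within_factor K (sub_bessel_heat \<sigma> \<zeta> t r s) (Q_bound \<zeta> \<alpha> t r s)"
proof -
  obtain L where L: "\<And>r s t. 0 < r \<Longrightarrow> 0 < s \<Longrightarrow> 0 < t \<Longrightarrow>
      within_factor L (bessel_heat \<zeta> t r s) (heat_profile \<zeta> t r s)"
    using bessel_heat_within_factor[OF assms(1)] by blast
  define K where "K = L * max (max (far_factor \<zeta>) (near_factor \<zeta> \<alpha>)) (1 / lower_factor \<zeta> \<alpha>)
    * ((1 + 2 powr \<bar>2 * \<zeta>\<bar>) * 8 powr \<bar>\<zeta>\<bar>)"
  have "within_factor K (sub_bessel_heat \<sigma> \<zeta> t r s) (Q_bound \<zeta> \<alpha> t r s)"
    if "stable_subordinator_density \<alpha> \<sigma>" and rst: "0 < r" "0 < s" "0 < t" for \<sigma> r s t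
  proof -
    interpret subordinated_bessel \<zeta> \<alpha> r s t L \<sigma>
      using assms that L by unfold_locales
    show ?thesis
      unfolding K_def using sub_bessel_heat_within_factor
        within_factor_sym[OF Q_bound_within_factor[OF assms(1,2) rst]]
      by (rule within_factor_trans)
  qed
  from within_factor_mono[OF this, of _ _ _ _ "max 1 K"] show ?thesis
    by (intro that[of "max 1 K"]) auto
qed

theorem theorem2p1:
  fixes \<zeta> :: real
  assumes "\<zeta> > -1/2"
  shows "(\<exists>c1 c2 c3 c4 c5 c6 c7 c8 :: real.
            c1 > 0 \<and> c2 > 0 \<and> c3 > 0 \<and> c4 > 0 \<and> c5 > 0 \<and> c6 > 0 \<and> c7 > 0 \<and> c8 > 0 \<and>
            (\<forall>r s t :: real. r > 0 \<longrightarrow> s > 0 \<longrightarrow> t > 0 \<longrightarrow>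
               c1 * t powr (-1/2) * exp (- (r - s)\<^sup>2 / (c2 * t)) / (r * s + t) powr \<zeta>
                 \<le> bessel_heat \<zeta> t r s \<and>
               bessel_heat \<zeta> t r s
                 \<le> c3 * t powr (-1/2) * exp (- (r - s)\<^sup>2 / (c4 * t)) / (r * s + t) powr \<zeta> \<and>
               c5 * A_zeta \<zeta> t r s * exp (- (r - s)\<^sup>2 / (c6 * t)) \<le> bessel_heat \<zeta> t r s \<and>
               bessel_heat \<zeta> t r s \<le> c7 * A_zeta \<zeta> t r s * exp (- (r - s)\<^sup>2 / (c8 * t))))
       \<and> (\<forall>\<alpha>::real. 0 < \<alpha> \<longrightarrow> \<alpha> < 2 \<longrightarrow>
            (\<exists>K::real. K \<ge> 1 \<and>
               (\<forall>\<sigma>. stable_subordinator_density \<alpha> \<sigma> \<longrightarrow>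
                  (\<forall>r s t :: real. r > 0 \<longrightarrow> s > 0 \<longrightarrow> t > 0 \<longrightarrow>
                     Q_bound \<zeta> \<alpha> t r s / K \<le> sub_bessel_heat \<sigma> \<zeta> t r s \<and>
                     sub_bessel_heat \<sigma> \<zeta> t r s \<le> K * Q_bound \<zeta> \<alpha> t r s))))"
proof (intro conjI allI impI, goal_cases)
  case 1
  obtain K where K: "0 < K"
    "\<And>r s t. 0 < r \<Longrightarrow> 0 < s \<Longrightarrow> 0 < t \<Longrightarrow> 1 / K * heat_profile \<zeta> t r s \<le> bessel_heat \<zeta> t r s"
    "\<And>r s t. 0 < r \<Longrightarrow> 0 < s \<Longrightarrow> 0 < t \<Longrightarrow> bessel_heat \<zeta> t r s \<le> K * heat_profile \<zeta> t r s"
    "\<And>r s t. 0 < r \<Longrightarrow> 0 < s \<Longrightarrow> 0 < t \<Longrightarrow>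
      1 / K * (A_zeta \<zeta> t r s * exp (- (r - s)\<^sup>2 / (8/3 * t))) \<le> bessel_heat \<zeta> t r s"
    "\<And>r s t. 0 < r \<Longrightarrow> 0 < s \<Longrightarrow> 0 < t \<Longrightarrow>
      bessel_heat \<zeta> t r s \<le> K * (A_zeta \<zeta> t r s * exp (- (r - s)\<^sup>2 / (8 * t)))"
    using bessel_heat_bounds[OF assms] by blast
  show ?case
    by (rule exI[of _ "1 / K"], rule exI[of _ 4], rule exI[of _ K], rule exI[of _ 4],
        rule exI[of _ "1 / K"], rule exI[of _ "8/3"], rule exI[of _ K], rule exI[of _ 8])
      (use K in \<open>simp add: heat_profile_def mult.assoc\<close>)
next
  case (2 \<alpha>)
  then obtain K where K: "1 \<le> K"
    "\<And>\<sigma> r s t. stable_subordinator_density \<alpha> \<sigma> \<Longrightarrow> 0 < r \<Longrightarrow> 0 < s \<Longrightarrow> 0 < t \<Longrightarrow>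
      within_factor K (sub_bessel_heat \<sigma> \<zeta> t r s) (Q_bound \<zeta> \<alpha> t r s)"
    using sub_bessel_heat_Q_bound[OF assms] by blast
  then show ?case
    by (intro exI[of _ K]) (auto simp: within_factor_def pos_divide_le_eq mult.commute)
qed

end
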